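(* Let $\Gamma$ be the random bipartite graph with sides $R_l, R_r$. If $G$ is a closed subgroup of $Sym_{\{l,r\}}(\Gamma)$ with $Aut(\Gamma)^*\leq G< Sym_{\{l, r\}}(\Gamma)$ (the last inclusion being proper), then there exists a subset $X\subseteq \{l, r\}$ such that $G=S_X(\Gamma)^*$.
   Context: A bipartite graph is a structure $(V,R_l,R_r,P_1,P_2)$ where $V$ is the disjoint union of nonempty sets $R_l$ and $R_r$ (the sides), and $P_1,P_2\subseteq R_l\times R_r$ are disjoint with $P_1\cup P_2=R_l\times R_r$ ($P_1$ is "edge", $P_2$ is "non-edge"). A pair $(a,b)\in R_l\times R_r$ is called a cross-edge; it has cross-type $P_i$ if $P_i(a,b)$ holds. For $n\in\mathbb N$, the extension property $\Theta_n$ says: for any disjoint $X_{l1},X_{l2}\subseteq R_l$ of size at most $n$ and any disjoint $X_{r1},X_{r2}\subseteq R_r$ of size at most $n$, (a) there is $v\in R_r$ such that $P_i(x,v)$ for every $x\in X_{li}$, $i=1,2$; and (b) there is $w\in R_l$ such that $P_i(w,x)$ for every $x\in X_{ri}$, $i=1,2$. The random bipartite graph $\Gamma$ is the countable bipartite graph satisfying $\Theta_n$ for every $n\in\mathbb N$; it is unique up to isomorphism. $Sym_{\{l,r\}}(\Gamma)=Sym(R_l)\times Sym(R_r)$ is the group of all permutations of the vertex set of $\Gamma$ preserving each side. "Closed" refers to the topology of pointwise convergence. $Aut(\Gamma)$ is the automorphism group of $\Gamma$ (in the language $R_l,R_r,P_1,P_2$). For a set $A$ of vertices of $\Gamma$,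 a bijection $\sigma:\Gamma\to\Gamma$ is a switch with respect to $A$ if for all $(a,b)\in R_l\times R_r$ and $i=1,2$: $[P_i(a,b)\leftrightarrow P_i(\sigma(a),\sigma(b))]$ holds if and only if $|\{a,b\}\cap A|\neq 1$. A switch with respect to a vertex $v$ is a switch with respect to $\{v\}$. For $X\subseteq\{l,r\}$, $S_X(\Gamma)$ is the closed subgroup of $Sym_{\{l,r\}}(\Gamma)$ generated (as a topological group) by $Aut(\Gamma)$ together with all $\sigma\in Sym_{\{l,r\}}(\Gamma)$ that are a switch with respect to some vertex $v\in R_i$ for some $i\in X$. Fix $\rho\in Sym_{\{l,r\}}(\Gamma)$ which is a switch with respect to $R_l$ (so $\rho$ exchanges the cross-types of all cross-edges). For a subgroup $G$, $G^*$ is the closed group generated by $G$ and $\rho$. In particular $Aut(\Gamma)^*=S_\emptyset(\Gamma)^*$ is the group of all side-preserving permutations that either preserve all cross-types or exchange all cross-types on $R_l\times R_r$. *)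

theory Defs
  imports "HOL-Analysis.Function_Topology" "HOL-Algebra.Bij"
begin

datatype side = L | R

record 'v bigraph =
  Rl :: "'v set"
  Rr :: "'v set"
  P1 :: "('v \<times> 'v) set"
  P2 :: "('v \<times> 'v) set"

definition verts :: "'v bigraph \<Rightarrow> 'v set" where
  "verts \<Gamma> = Rl \<Gamma> \<union> Rr \<Gamma>"

fun side_set :: "'v bigraph \<Rightarrow> side \<Rightarrow> 'v set" where
  "side_set \<Gamma> L = Rl \<Gamma>"
| "side_set \<Gamma> R = Rr \<Gamma>"

definition bipartite_graph :: "'v bigraph \<Rightarrow> bool" where
  "bipartite_graph \<Gamma> \<longleftrightarrow>
     Rl \<Gamma> \<noteq> {} \<and> Rr \<Gamma> \<noteq> {} \<and> Rl \<Gamma> \<inter> Rr \<Gamma> = {} \<and>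
     P1 \<Gamma> \<inter> P2 \<Gamma> = {} \<and> P1 \<Gamma> \<union> P2 \<Gamma> = Rl \<Gamma> \<times> Rr \<Gamma>"

definition size_at_most :: "nat \<Rightarrow> 'v set \<Rightarrow> bool" where
  "size_at_most n X \<longleftrightarrow> finite X \<and> card X \<le> n"

definition extension_property :: "'v bigraph \<Rightarrow> nat \<Rightarrow> bool" where
  "extension_property \<Gamma> n \<longleftrightarrow>
     (\<forall>Xl1 Xl2 Xr1 Xr2.
        Xl1 \<subseteq> Rl \<Gamma> \<and> Xl2 \<subseteq> Rl \<Gamma> \<and> Xl1 \<inter> Xl2 = {} \<and>
        size_at_most n Xl1 \<and> size_at_most n Xl2 \<and>
        Xr1 \<subseteq> Rr \<Gamma> \<and> Xr2 \<subseteq> Rr \<Gamma> \<and> Xr1 \<inter> Xr2 = {} \<and>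
        size_at_most n Xr1 \<and> size_at_most n Xr2 \<longrightarrow>
        (\<exists>v\<in>Rr \<Gamma>. (\<forall>x\<in>Xl1. (x, v) \<in> P1 \<Gamma>) \<and> (\<forall>x\<in>Xl2. (x, v) \<in> P2 \<Gamma>)) \<and>
        (\<exists>w\<in>Rl \<Gamma>. (\<forall>x\<in>Xr1. (w, x) \<in> P1 \<Gamma>) \<and> (\<forall>x\<in>Xr2. (w, x) \<in> P2 \<Gamma>)))"

definition random_bipartite_graph :: "'v bigraph \<Rightarrow> bool" where
  "random_bipartite_graph \<Gamma> \<longleftrightarrow>
     bipartite_graph \<Gamma> \<and> countable (verts \<Gamma>) \<and> (\<forall>n. extension_property \<Gamma> n)"

text \<open>Permutations of the vertex set are elements of \<^term>\<open>Bij (verts \<Gamma>)\<close>, i.e. bijections of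
  the vertex set that are \<^const>\<open>undefined\<close> outside it.  This is the convention of both
  \<^const>\<open>BijGroup\<close> and \<^const>\<open>product_topology\<close>.\<close>

definition Sym_lr :: "'v bigraph \<Rightarrow> ('v \<Rightarrow> 'v) monoid" where
  "Sym_lr \<Gamma> = (BijGroup (verts \<Gamma>))
     \<lparr>carrier := {f \<in> Bij (verts \<Gamma>). f ` Rl \<Gamma> = Rl \<Gamma> \<and> f ` Rr \<Gamma> = Rr \<Gamma>}\<rparr>"

text \<open>The topology of pointwise convergence, the vertex set being discrete.\<close>

definition Sym_lr_top :: "'v bigraph \<Rightarrow> ('v \<Rightarrow> 'v) topology" where
  "Sym_lr_top \<Gamma> =
     subtopology (product_topology (\<lambda>_. discrete_topology (verts \<Gamma>)) (verts \<Gamma>))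
       (carrier (Sym_lr \<Gamma>))"

definition closed_subgroup :: "'v bigraph \<Rightarrow> ('v \<Rightarrow> 'v) set \<Rightarrow> bool" where
  "closed_subgroup \<Gamma> G \<longleftrightarrow> subgroup G (Sym_lr \<Gamma>) \<and> closedin (Sym_lr_top \<Gamma>) G"

text \<open>The least closed subgroup containing \<open>S\<close>; junk unless \<open>S\<close> is contained in the carrier of \<^term>\<open>Sym_lr \<Gamma>\<close>.\<close>

definition closed_generate :: "'v bigraph \<Rightarrow> ('v \<Rightarrow> 'v) set \<Rightarrow> ('v \<Rightarrow> 'v) set" where
  "closed_generate \<Gamma> S = \<Inter>{H. closed_subgroup \<Gamma> H \<and> S \<subseteq> H}"

definition Aut :: "'v bigraph \<Rightarrow> ('v \<Rightarrow> 'v) set" where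
  "Aut \<Gamma> = {f \<in> Bij (verts \<Gamma>).
     (\<forall>x\<in>verts \<Gamma>. (x \<in> Rl \<Gamma> \<longleftrightarrow> f x \<in> Rl \<Gamma>) \<and> (x \<in> Rr \<Gamma> \<longleftrightarrow> f x \<in> Rr \<Gamma>)) \<and>
     (\<forall>x\<in>verts \<Gamma>. \<forall>y\<in>verts \<Gamma>.
        ((x, y) \<in> P1 \<Gamma> \<longleftrightarrow> (f x, f y) \<in> P1 \<Gamma>) \<and> ((x, y) \<in> P2 \<Gamma> \<longleftrightarrow> (f x, f y) \<in> P2 \<Gamma>))}"

definition is_switch :: "'v bigraph \<Rightarrow> 'v set \<Rightarrow> ('v \<Rightarrow> 'v) \<Rightarrow> bool" where
  "is_switch \<Gamma> A \<sigma> \<longleftrightarrow> \<sigma> \<in> Bij (verts \<Gamma>) \<and>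
     (\<forall>a\<in>Rl \<Gamma>. \<forall>b\<in>Rr \<Gamma>. \<forall>P\<in>{P1 \<Gamma>, P2 \<Gamma>}.
        ((a, b) \<in> P \<longleftrightarrow> (\<sigma> a, \<sigma> b) \<in> P) \<longleftrightarrow> card ({a, b} \<inter> A) \<noteq> 1)"

definition switch_group :: "'v bigraph \<Rightarrow> side set \<Rightarrow> ('v \<Rightarrow> 'v) set" where
  "switch_group \<Gamma> X = closed_generate \<Gamma>
     (Aut \<Gamma> \<union> {\<sigma> \<in> carrier (Sym_lr \<Gamma>). \<exists>i\<in>X. \<exists>v\<in>side_set \<Gamma> i. is_switch \<Gamma> {v} \<sigma>})"

text \<open>Written \<open>G\<^sup>*\<close>; here \<open>\<rho>\<close> is meant to be a side-preserving switch with respect to \<^term>\<open>Rl \<Gamma>\<close>.\<close>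

definition star_group ::
    "'v bigraph \<Rightarrow> ('v \<Rightarrow> 'v) \<Rightarrow> ('v \<Rightarrow> 'v) set \<Rightarrow> ('v \<Rightarrow> 'v) set" where
  "star_group \<Gamma> \<rho> G = closed_generate \<Gamma> (G \<union> {\<rho>})"

end

(* Write M a b for "(a, b) is an edge". Given a finite set B of columns, call two rows exchangeable
   over B if their transposition is in the closure of the action on rows of the pointwise
   stabiliser of B in G; rows with equal entries on B are exchangeable by homogeneity. If all rows
   are exchangeable over every B, then G is the full group. Otherwise take B of least size n + 1 for
   which this fails. Moving three rows over n of the columns to rows with equal entries there shows
   that there are only two classes, and changing one entry must change the class, so
   exchangeability over B is the parity of the Hamming distance. Hence G preserves the parity of
   every 2 x 2 rectangle of M, and if n = 0 every element of G flips all entries of a column or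
   none. If instead n > 0, then G realises every row flip, since a pigeonhole argument removes the
   accompanying column flips. The same holds with rows and columns interchanged, and X records on
   which of the two sides n > 0. *)

theory Submission
  imports Defs "HOL-Combinatorics.Transposition"
begin

section \<open>Back-and-forth between random bipartite graphs\<close>

text \<open>For g in G let d a b say that g changes the entry at (a, b). Even parity of d on
  rectangles means that d a b is the exclusive or of a function of a and a function of b, and these
  two functions are determined up to negating both. So only row flips, column flips and a global
  constant can occur; the constant is what \<open>\<rho>\<close> supplies, and it is also the error
  that the pigeonhole argument leaves behind. Exchangeability is defined by transpositions and not
  by orbits for two reasons: conjugation makes it a G-invariant equivalence relation on rows, and if
  all rows are exchangeable over B, then every finite injection of rows extends to an element of G
  fixing B. The obstacle is that such an element moves the columns outside B in an uncontrolled way.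
  The parity argument therefore uses only that an entry in the unknown image column has two possible
  values.\<close>

definition side_perm :: "'v set \<Rightarrow> 'v set \<Rightarrow> ('v \<Rightarrow> 'v) \<Rightarrow> bool" where
  "side_perm U V f \<longleftrightarrow> bij f \<and> f ` U = U \<and> f ` V = V"

lemma side_perm_comp: "side_perm U V f \<Longrightarrow> side_perm U V g \<Longrightarrow> side_perm U V (f \<circ> g)"
  unfolding side_perm_def by (metis bij_comp image_comp)

lemma side_perm_inv: "side_perm U V f \<Longrightarrow> side_perm U V (inv_into UNIV f)"
  unfolding side_perm_def by (metis bij_imp_bij_inv bij_is_inj image_inv_f_f)

lemma side_perm_commute: "side_perm U V f \<longleftrightarrow> side_perm V U f"
  unfolding side_perm_def by auto

lemma side_perm_mem:
  assumes "side_perm U V f"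
  shows "f x \<in> U \<longleftrightarrow> x \<in> U" "f x \<in> V \<longleftrightarrow> x \<in> V"
  using assms unfolding side_perm_def by (metis bij_is_inj inj_image_mem_iff)+

lemma side_perm_inv_simps:
  assumes "side_perm U V f"
  shows "inv_into UNIV f (f x) = x" "f (inv_into UNIV f x) = x"
  using assms unfolding side_perm_def by (simp_all add: bij_is_inj bij_is_surj surj_f_inv_f)

text \<open>Greedy choice of distinct representatives: the finitely many values already taken cannot
  exhaust an infinite set.\<close>

lemma inj_choice:
  assumes "finite A" "\<And>a. a \<in> A \<Longrightarrow> infinite (S a)"
  shows "\<exists>f. inj_on f A \<and> (\<forall>a\<in>A. f a \<in> S a)"
  using assms
proof (induction A)
  case (insert x A)
  then obtain f where f: "inj_on f A" "\<forall>a\<in>A. f a \<in> S a"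
    by auto
  have "infinite (S x - f ` A)"
    using insert by simp
  then obtain y where y: "y \<in> S x" "y \<notin> f ` A"
    by (metis Diff_iff ex_in_conv finite.emptyI)
  have "inj_on (f(x := y)) (insert x A)"
    using f(1) y(2) insert.hyps(2) by (auto simp: inj_on_def)
  moreover have "\<forall>a\<in>insert x A. (f(x := y)) a \<in> S a"
    using f(2) y(1) insert.hyps(2) by auto
  ultimately show ?case by blast
qed auto

section \<open>Random bipartite graphs as Boolean matrices\<close>

locale random_bip =
  fixes U V :: "'v set" and M :: "'v \<Rightarrow> 'v \<Rightarrow> bool"
  assumes disj: "U \<inter> V = {}"
    and count: "countable U" "countable V"
    and ext_col: "\<And>X t. finite X \<Longrightarrow> X \<subseteq> U \<Longrightarrow> \<exists>v\<in>V. \<forall>x\<in>X. M x v = t x"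
    and ext_row: "\<And>Y t. finite Y \<Longrightarrow> Y \<subseteq> V \<Longrightarrow> \<exists>u\<in>U. \<forall>y\<in>Y. M u y = t y"
begin

text \<open>Transposing the matrix exchanges rows and columns; results are proved for one side and
  transferred through this symmetry.\<close>

lemma dual: "random_bip V U (\<lambda>b a. M a b)"
  using disj count ext_col ext_row by unfold_locales auto

text \<open>Every subset of \<open>X\<close> is the trace of some column. If both sides were finite,
  the two exponential bounds would contradict each other.\<close>

lemma card_col_ge:
  assumes "finite X" "X \<subseteq> U" "finite V"
  shows "2 ^ card X \<le> card V"
proof -
  have "Pow X \<subseteq> (\<lambda>v. {x\<in>X. M x v}) ` V"
  proof
    fix Z assume "Z \<in> Pow X"
    obtain v where "v \<in> V" "\<forall>x\<in>X. M x v = (x \<in> Z)"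
      using ext_col[of X "\<lambda>x. x \<in> Z"] assms by auto
    then show "Z \<in> (\<lambda>v. {x\<in>X. M x v}) ` V"
      using \<open>Z \<in> Pow X\<close> by (intro image_eqI[of _ _ v]) auto
  qed
  then have "card (Pow X) \<le> card V"
    using assms(3) by (rule surj_card_le[rotated])
  then show ?thesis
    using assms(1) by (simp add: card_Pow)
qed

lemma infinite_col: "infinite V"
proof
  assume fin: "finite V"
  show False
  proof (cases "finite U")
    case True
    then have "2 ^ card U \<le> card V" "2 ^ card V \<le> card U"
      using card_col_ge[of U] random_bip.card_col_ge[OF dual, of V] fin by auto
    then show False
      using less_exp[of "card U"] less_exp[of "card V"] by linarith
  next
    case False
    then obtain X where "X \<subseteq> U" "finite X" "card X = card V"
      using infinite_arbitrarily_large by blast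
    then show False
      using card_col_ge[of X] fin less_exp[of "card V"] by simp
  qed
qed

lemma infinite_row: "infinite U"
  by (rule random_bip.infinite_col[OF dual])

text \<open>A single column \<open>z\<close> is avoided by adding a fresh row \<open>x'\<close> to
  the condition and asking there for the entry opposite to that of \<open>z\<close>; the induction
  removes the members of \<open>Z\<close> one by one.\<close>

lemma ext_col_avoid:
  assumes "finite Z" "finite X" "X \<subseteq> U"
  shows "\<exists>v\<in>V - Z. \<forall>x\<in>X. M x v = t x"
  using assms
proof (induction Z arbitrary: X t)
  case empty
  then show ?case using ext_col by auto
next
  case (insert z Z)
  have "infinite (U - X)"
    using infinite_row insert.prems(1) by simp
  then obtain x' where x': "x' \<in> U" "x' \<notin> X"
    by (metis Diff_iff ex_in_conv finite.emptyI)
  obtain v where v: "v \<in> V - Z" "\<forall>x\<in>insert x' X. M x v = (t(x' := \<not> M x' z)) x"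
    using insert.IH[of "insert x' X" "t(x' := \<not> M x' z)"] insert.prems x' by auto
  then have "v \<noteq> z" by auto
  then show ?case
    using v x'(2) by (intro bexI[of _ v]) auto
qed

lemma infinite_col_type:
  assumes "finite X" "X \<subseteq> U"
  shows "infinite {v\<in>V. \<forall>x\<in>X. M x v = t x}"
proof
  assume "finite {v\<in>V. \<forall>x\<in>X. M x v = t x}"
  from ext_col_avoid[OF this assms] show False by auto
qed

lemma infinite_row_type:
  assumes "finite Y" "Y \<subseteq> V"
  shows "infinite {u\<in>U. \<forall>y\<in>Y. M u y = t y}"
  using random_bip.infinite_col_type[OF dual assms] .

end

section \<open>Finite partial isomorphisms and back-and-forth chains\<close>

definition partial_iso ::
  "'v set \<Rightarrow> 'v set \<Rightarrow> ('v \<Rightarrow> 'v \<Rightarrow> bool) \<Rightarrow> ('v \<Rightarrow> 'v \<Rightarrow> bool) \<Rightarrow> ('v \<times> 'v) set \<Rightarrow> bool" where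
  "partial_iso U V M N p \<longleftrightarrow> finite p \<and> p \<subseteq> U \<times> U \<union> V \<times> V \<and>
     (\<forall>x y x' y'. (x, y) \<in> p \<longrightarrow> (x', y') \<in> p \<longrightarrow> (x = x' \<longleftrightarrow> y = y')) \<and>
     (\<forall>a a' b b'. (a, a') \<in> p \<longrightarrow> (b, b') \<in> p \<longrightarrow> a \<in> U \<longrightarrow> b \<in> V \<longrightarrow> N a' b' = M a b)"

lemma partial_isoI:
  assumes "finite p" "p \<subseteq> U \<times> U \<union> V \<times> V"
    "\<And>x y x' y'. (x, y) \<in> p \<Longrightarrow> (x', y') \<in> p \<Longrightarrow> x = x' \<longleftrightarrow> y = y'"
    "\<And>a a' b b'. (a, a') \<in> p \<Longrightarrow> (b, b') \<in> p \<Longrightarrow> a \<in> U \<Longrightarrow> b \<in> V \<Longrightarrow> N a' b' = M a b"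
  shows "partial_iso U V M N p"
  using assms unfolding partial_iso_def by simp

lemma partial_isoD:
  assumes "partial_iso U V M N p"
  shows "finite p" "p \<subseteq> U \<times> U \<union> V \<times> V"
    "\<And>x y x' y'. (x, y) \<in> p \<Longrightarrow> (x', y') \<in> p \<Longrightarrow> x = x' \<longleftrightarrow> y = y'"
    "\<And>a a' b b'. (a, a') \<in> p \<Longrightarrow> (b, b') \<in> p \<Longrightarrow> a \<in> U \<Longrightarrow> b \<in> V \<Longrightarrow> N a' b' = M a b"
  using assms unfolding partial_iso_def by simp_all

lemma partial_iso_dual:
  "partial_iso U V M N p \<Longrightarrow> partial_iso V U (\<lambda>b a. M a b) (\<lambda>b a. N a b) p"
  unfolding partial_iso_def by blast

text \<open>Working with relations makes the "back" step a "forth" step for the converse, with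
  \<open>M\<close> and \<open>N\<close> interchanged.\<close>

lemma partial_iso_converse:
  assumes "U \<inter> V = {}" "partial_iso U V M N p"
  shows "partial_iso U V N M (p\<inverse>)"
proof -
  note p = partial_isoD[OF assms(2)]
  have "a \<in> U" if "(a, a') \<in> p" "a' \<in> U" for a a'
    using p(2) assms(1) that by auto
  moreover have "a \<in> V" if "(a, a') \<in> p" "a' \<in> V" for a a'
    using p(2) assms(1) that by auto
  ultimately show ?thesis
    using p by (intro partial_isoI) (auto simp del: UN_iff)
qed

lemma partial_iso_add_row:
  assumes "random_bip U V N" "partial_iso U V M N p" "x \<in> U"
  shows "\<exists>q. partial_iso U V M N q \<and> p \<subseteq> q \<and> x \<in> Domain q"
proof (cases "x \<in> Domain p")
  case True
  then show ?thesis using assms(2) by blast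
next
  case False
  interpret random_bip U V N by fact
  note p = partial_isoD[OF assms(2)]
  define C where "C = {u\<in>U. \<forall>y\<in>Range p \<inter> V. N u y = (\<exists>b. (b, y) \<in> p \<and> M x b)} - Range p"
  have "infinite C"
    unfolding C_def using infinite_row_type[of "Range p \<inter> V"] p(1) by (simp add: finite_Range)
  then obtain u where "u \<in> C"
    using infinite_imp_nonempty by blast
  then have u: "u \<in> U" "u \<notin> Range p"
    "\<forall>y\<in>Range p \<inter> V. N u y = (\<exists>b. (b, y) \<in> p \<and> M x b)"
    by (simp_all add: C_def)
  have row: "N u b' = M x b" if "(b, b') \<in> p" "b \<in> V" for b b'
  proof -
    have "b' \<in> Range p \<inter> V"
      using that p(2) disj by auto
    then have "N u b' = (\<exists>c. (c, b') \<in> p \<and> M x c)"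
      using u(3) by blast
    then show ?thesis
      using p(3) that(1) by blast
  qed
  have "partial_iso U V M N (insert (x, u) p)"
  proof (rule partial_isoI)
    fix a a' b b'
    assume ab: "(a, a') \<in> insert (x, u) p" "(b, b') \<in> insert (x, u) p" "a \<in> U" "b \<in> V"
    then have b: "(b, b') \<in> p"
      using disj assms(3) by auto
    show "N a' b' = M a b"
    proof (cases "(a, a') \<in> p")
      case True
      then show ?thesis using p(4) b ab(3,4) by blast
    next
      case False
      then show ?thesis using row b ab by simp
    qed
  next
    fix a a' b b'
    assume ab: "(a, a') \<in> insert (x, u) p" "(b, b') \<in> insert (x, u) p"
    have "c \<noteq> x \<and> c' \<noteq> u" if "(c, c') \<in> p" for c c'
      using that False u(2) by blast
    then show "(a = b) = (a' = b')"
      using ab p(3) by (metis Pair_inject insert_iff)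
  qed (use p(1,2) assms(3) u(1) in auto)
  then show ?thesis by blast
qed

lemma partial_iso_add_domain:
  assumes "random_bip U V N" "partial_iso U V M N p" "x \<in> U \<union> V"
  shows "\<exists>q. partial_iso U V M N q \<and> p \<subseteq> q \<and> x \<in> Domain q"
proof (cases "x \<in> U")
  case True
  then show ?thesis using partial_iso_add_row[OF assms(1,2)] by simp
next
  case False
  then obtain q where "partial_iso V U (\<lambda>b a. M a b) (\<lambda>b a. N a b) q" "p \<subseteq> q" "x \<in> Domain q"
    using partial_iso_add_row[OF random_bip.dual[OF assms(1)] partial_iso_dual[OF assms(2)]] assms(3)
    by blast
  then show ?thesis
    using partial_iso_dual[of V U "\<lambda>b a. M a b" "\<lambda>b a. N a b" q] by auto
qed

lemma partial_iso_step:
  assumes "random_bip U V M" "random_bip U V N" "partial_iso U V M N p" "x \<in> U \<union> V"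
  shows "\<exists>q. partial_iso U V M N q \<and> p \<subseteq> q \<and> x \<in> Domain q \<and> x \<in> Range q"
proof -
  have disj: "U \<inter> V = {}"
    using assms(1) random_bip.disj by blast
  obtain q where q: "partial_iso U V M N q" "p \<subseteq> q" "x \<in> Domain q"
    using partial_iso_add_domain[OF assms(2-4)] by blast
  obtain r where r: "partial_iso U V N M r" "q\<inverse> \<subseteq> r" "x \<in> Domain r"
    using partial_iso_add_domain[OF assms(1) partial_iso_converse[OF disj q(1)] assms(4)] by blast
  then show ?thesis
    using partial_iso_converse[OF disj r(1)] q by (intro exI[of _ "r\<inverse>"]) auto
qed

text \<open>Two matrices are allowed because the construction serves two purposes:
  \<open>N = M\<close> gives homogeneity, and a source matrix with flipped columns gives the
  existence of switches.\<close>

lemma iso_extends: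
  assumes M: "random_bip U V M" and N: "random_bip U V N"
    and F: "finite F" "F \<subseteq> U \<union> V" "inj_on \<kappa> F" "\<kappa> ` (F \<inter> U) \<subseteq> U" "\<kappa> ` (F \<inter> V) \<subseteq> V"
    and pres: "\<And>a b. a \<in> F \<inter> U \<Longrightarrow> b \<in> F \<inter> V \<Longrightarrow> N (\<kappa> a) (\<kappa> b) = M a b"
  shows "\<exists>f. side_perm U V f \<and> (\<forall>x\<in>F. f x = \<kappa> x) \<and> (\<forall>a\<in>U. \<forall>b\<in>V. N (f a) (f b) = M a b)"
proof -
  interpret random_bip U V M by fact
  define e where "e = from_nat_into (U \<union> V)"
  have ne: "U \<union> V \<noteq> {}"
    using infinite_col by auto
  have e: "range e = U \<union> V"
    unfolding e_def using ne count by (intro range_from_nat_into) auto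
  define p0 where "p0 = (\<lambda>x. (x, \<kappa> x)) ` F"
  have p0: "partial_iso U V M N p0"
  proof (rule partial_isoI)
    show "finite p0" using F by (simp add: p0_def)
    show "p0 \<subseteq> U \<times> U \<union> V \<times> V"
      using F(2,4,5) by (fastforce simp: p0_def)
    show "x = x' \<longleftrightarrow> y = y'" if "(x, y) \<in> p0" "(x', y') \<in> p0" for x y x' y'
      using that F(3) by (auto simp: p0_def inj_on_def)
    show "N a' b' = M a b" if "(a, a') \<in> p0" "(b, b') \<in> p0" "a \<in> U" "b \<in> V" for a a' b b'
      using that pres by (auto simp: p0_def)
  qed
  \<comment> \<open>The clause for \<open>n = 0\<close> pins the start of the chain to the given
    finite map; dependent choice by itself returns an arbitrary start.\<close>
  define Q where "Q n p \<longleftrightarrow> partial_iso U V M N p \<and> (n = 0 \<longrightarrow> p = p0)" for n :: nat and p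
  have "\<exists>r. \<forall>n. Q n (r n) \<and> (r n \<subseteq> r (Suc n) \<and> e n \<in> Domain (r (Suc n)) \<and> e n \<in> Range (r (Suc n)))"
  proof (rule dependent_nat_choice)
    show "\<exists>p. Q 0 p" using p0 by (auto simp: Q_def)
  next
    fix p n
    assume "Q n p"
    moreover have "e n \<in> U \<union> V" using e by blast
    ultimately obtain q where "partial_iso U V M N q" "p \<subseteq> q" "e n \<in> Domain q" "e n \<in> Range q"
      using partial_iso_step[OF M N, of p "e n"] by (auto simp: Q_def)
    then show "\<exists>q. Q (Suc n) q \<and> p \<subseteq> q \<and> e n \<in> Domain q \<and> e n \<in> Range q"
      by (auto simp: Q_def)
  qed
  then obtain r where r: "\<And>n. Q n (r n)" "\<And>n. r n \<subseteq> r (Suc n)"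
    "\<And>n. e n \<in> Domain (r (Suc n))" "\<And>n. e n \<in> Range (r (Suc n))"
    by blast
  have mono: "r m \<subseteq> r n" if "m \<le> n" for m n
    using lift_Suc_mono_le[of r, OF r(2) that] .
  define S where "S = (\<Union>n. r n)"
  have joint: "\<exists>n. z \<in> r n \<and> z' \<in> r n" if zz: "z \<in> S" "z' \<in> S" for z z'
  proof -
    obtain m n where "z \<in> r m" "z' \<in> r n"
      using zz unfolding S_def by blast
    then show ?thesis
      using mono[of m "max m n"] mono[of n "max m n"] by (intro exI[of _ "max m n"]) auto
  qed
  have iso: "partial_iso U V M N (r n)" for n
    using r(1) by (simp add: Q_def)
  have S_inj: "x = x' \<longleftrightarrow> y = y'" if "(x, y) \<in> S" "(x', y') \<in> S" for x y x' y'
    using joint[OF that] partial_isoD(3)[OF iso] by blast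
  have S_pres: "N a' b' = M a b" if "(a, a') \<in> S" "(b, b') \<in> S" "a \<in> U" "b \<in> V" for a a' b b'
    using joint[OF that(1,2)] partial_isoD(4)[OF iso] that(3,4) by blast
  have S_sub: "S \<subseteq> U \<times> U \<union> V \<times> V"
    using partial_isoD(2)[OF iso] unfolding S_def by blast
  have S_dom: "\<exists>y. (x, y) \<in> S" if x: "x \<in> U \<union> V" for x
  proof -
    obtain n where "x = e n" using x e by auto
    then show ?thesis using r(3)[of n] by (auto simp: S_def)
  qed
  have S_ran: "\<exists>y. (y, x) \<in> S" if x: "x \<in> U \<union> V" for x
  proof -
    obtain n where "x = e n" using x e by auto
    then show ?thesis using r(4)[of n] by (auto simp: S_def)
  qed
  \<comment> \<open>The identity off the vertices makes \<open>f\<close> a bijection of the whole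
    type, as \<open>side_perm\<close> demands.\<close>
  define f where "f x = (if x \<in> U \<union> V then THE y. (x, y) \<in> S else x)" for x
  have f_eq: "f x = y" if "(x, y) \<in> S" for x y
  proof -
    have "(THE y. (x, y) \<in> S) = y"
      using S_inj that by (intro the_equality) blast+
    moreover have "x \<in> U \<union> V"
      using that S_sub by blast
    ultimately show ?thesis
      by (simp add: f_def)
  qed
  have f_in: "(x, f x) \<in> S" if "x \<in> U \<union> V" for x
    using S_dom[OF that] f_eq by auto
  have f_out: "f x = x" if "x \<notin> U \<union> V" for x
    using that by (simp add: f_def)
  have U: "f x \<in> U" if "x \<in> U" for x
    using f_in[of x] that S_sub disj by auto
  have V: "f x \<in> V" if "x \<in> V" for x
    using f_in[of x] that S_sub disj by auto
  have "inj f"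
  proof (rule injI)
    fix x y assume "f x = f y"
    then show "x = y"
      using f_in[of x] f_in[of y] f_out[of x] f_out[of y] U[of x] U[of y] V[of x] V[of y] S_inj
      by (metis Un_iff)
  qed
  moreover have "U \<subseteq> f ` U"
  proof
    fix y assume y: "y \<in> U"
    then obtain x where x: "(x, y) \<in> S" using S_ran by blast
    then have "x \<in> U" using y S_sub disj by auto
    then show "y \<in> f ` U" using f_eq[OF x] by auto
  qed
  moreover have "V \<subseteq> f ` V"
  proof
    fix y assume y: "y \<in> V"
    then obtain x where x: "(x, y) \<in> S" using S_ran by blast
    then have "x \<in> V" using y S_sub disj by auto
    then show "y \<in> f ` V" using f_eq[OF x] by auto
  qed
  moreover have "surj f"
    unfolding surj_def
  proof
    fix y show "\<exists>x. y = f x"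
      using S_ran[of y] f_eq[of _ y] f_out[of y] by metis
  qed
  ultimately have "side_perm U V f"
    unfolding side_perm_def bij_def using U V by auto
  moreover have "f x = \<kappa> x" if "x \<in> F" for x
  proof -
    have "(x, \<kappa> x) \<in> r 0"
      using r(1)[of 0] that by (auto simp: Q_def p0_def)
    then show ?thesis
      using f_eq by (auto simp: S_def)
  qed
  moreover have "N (f a) (f b) = M a b" if "a \<in> U" "b \<in> V" for a b
    using S_pres f_in that by blast
  ultimately show ?thesis by blast
qed

section \<open>Exchangeable rows\<close>

context random_bip
begin

lemma homogeneous:
  assumes "finite F" "F \<subseteq> U \<union> V" "inj_on \<kappa> F" "\<kappa> ` (F \<inter> U) \<subseteq> U" "\<kappa> ` (F \<inter> V) \<subseteq> V"
    and "\<And>a b. a \<in> F \<inter> U \<Longrightarrow> b \<in> F \<inter> V \<Longrightarrow> M (\<kappa> a) (\<kappa> b) = M a b"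
  shows "\<exists>f. side_perm U V f \<and> (\<forall>x\<in>F. f x = \<kappa> x) \<and> (\<forall>a\<in>U. \<forall>b\<in>V. M (f a) (f b) = M a b)"
  using iso_extends[OF random_bip_axioms random_bip_axioms assms] .

text \<open>A column of the wanted type is sought outside the finite set \<open>W\<close>, where
  nothing is flipped; for rows the prescription itself is flipped on \<open>W\<close>.\<close>

lemma switch_cols_random_bip:
  assumes "finite W"
  shows "random_bip U V (\<lambda>a b. M a b \<noteq> (b \<in> W))"
proof
  show "\<exists>v\<in>V. \<forall>x\<in>X. (M x v \<noteq> (v \<in> W)) = t x" if "finite X" "X \<subseteq> U" for X t
    using ext_col_avoid[OF assms that, of t] by auto
  show "\<exists>u\<in>U. \<forall>y\<in>Y. (M u y \<noteq> (y \<in> W)) = t y" if "finite Y" "Y \<subseteq> V" for Y t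
    using ext_row[OF that, of "\<lambda>y. t y \<noteq> (y \<in> W)"] by auto
qed (use disj count in auto)

lemma ex_switch_cols:
  assumes "finite W"
  shows "\<exists>s. side_perm U V s \<and> (\<forall>a\<in>U. \<forall>b\<in>V. M (s a) (s b) = (M a b \<noteq> (b \<in> W)))"
  using iso_extends[OF switch_cols_random_bip[OF assms] random_bip_axioms, of "{}" id] by auto

end

text \<open>\<open>closed\<close> is closedness under pointwise limits, tested on finite sets of
  vertices; this is the only form in which the topology enters. Elements are bijections of the whole
  type, and \<open>aut\<close> admits every one that preserves entries, whatever it does off the
  vertices.\<close>

locale bip_group = random_bip +
  fixes G :: "('v \<Rightarrow> 'v) set" and \<rho> :: "'v \<Rightarrow> 'v"
  assumes perm: "g \<in> G \<Longrightarrow> side_perm U V g"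
    and comp: "g \<in> G \<Longrightarrow> h \<in> G \<Longrightarrow> g \<circ> h \<in> G"
    and invs: "g \<in> G \<Longrightarrow> inv_into UNIV g \<in> G"
    and closed: "side_perm U V f \<Longrightarrow>
      (\<And>F. finite F \<Longrightarrow> F \<subseteq> U \<union> V \<Longrightarrow> \<exists>g\<in>G. \<forall>x\<in>F. g x = f x) \<Longrightarrow> f \<in> G"
    and aut: "side_perm U V f \<Longrightarrow> (\<And>a b. a \<in> U \<Longrightarrow> b \<in> V \<Longrightarrow> M (f a) (f b) = M a b) \<Longrightarrow> f \<in> G"
    and rho: "\<rho> \<in> G" "\<And>a b. a \<in> U \<Longrightarrow> b \<in> V \<Longrightarrow> M (\<rho> a) (\<rho> b) = (\<not> M a b)"
begin

lemma dual_group: "bip_group V U (\<lambda>b a. M a b) G \<rho>"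
proof (intro bip_group.intro dual bip_group_axioms.intro)
  show "f \<in> G" if "side_perm V U f"
    "\<And>F. finite F \<Longrightarrow> F \<subseteq> V \<union> U \<Longrightarrow> \<exists>g\<in>G. \<forall>x\<in>F. g x = f x" for f
    using closed[of f] that by (simp add: side_perm_commute Un_commute)
  show "f \<in> G" if "side_perm V U f" "\<And>a b. a \<in> V \<Longrightarrow> b \<in> U \<Longrightarrow> M (f b) (f a) = M b a" for f
    using aut[of f] that by (simp add: side_perm_commute)
  show "side_perm V U g" if "g \<in> G" for g
    using perm[OF that] by (simp add: side_perm_commute)
qed (simp_all add: comp invs rho)

lemma id_mem: "id \<in> G"
  by (rule aut) (simp_all add: side_perm_def)

lemma ex_aut:
  assumes "finite F" "F \<subseteq> U \<union> V" "inj_on \<kappa> F" "\<kappa> ` (F \<inter> U) \<subseteq> U" "\<kappa> ` (F \<inter> V) \<subseteq> V"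
    and "\<And>a b. a \<in> F \<inter> U \<Longrightarrow> b \<in> F \<inter> V \<Longrightarrow> M (\<kappa> a) (\<kappa> b) = M a b"
  shows "\<exists>k\<in>G. (\<forall>x\<in>F. k x = \<kappa> x) \<and> (\<forall>a\<in>U. \<forall>b\<in>V. M (k a) (k b) = M a b)"
  using homogeneous[OF assms] aut by blast

text \<open>By homogeneity, a closed group above the automorphism group is determined by the finite
  adjacency patterns that its elements produce.\<close>

lemma local_mem:
  assumes f: "side_perm U V f"
    and loc: "\<And>A B. finite A \<Longrightarrow> A \<subseteq> U \<Longrightarrow> finite B \<Longrightarrow> B \<subseteq> V \<Longrightarrow>
      \<exists>g\<in>G. \<forall>a\<in>A. \<forall>b\<in>B. M (g a) (g b) = M (f a) (f b)"
  shows "f \<in> G"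
proof (rule closed[OF f])
  fix F assume F: "finite F" "F \<subseteq> U \<union> V"
  obtain g where g: "g \<in> G" "\<forall>a\<in>F \<inter> U. \<forall>b\<in>F \<inter> V. M (g a) (g b) = M (f a) (f b)"
    using loc[of "F \<inter> U" "F \<inter> V"] F by auto
  note gp = perm[OF g(1)] and gi = side_perm_inv_simps[OF perm[OF g(1)]]
  \<comment> \<open>\<open>\<kappa>\<close> sends \<open>g x\<close> to \<open>f x\<close> and
    preserves the entries on the image of \<open>F\<close> under \<open>g\<close>. Homogeneity
    realises it there by some \<open>k\<close> in \<open>G\<close>, and \<open>k\<close> after
    \<open>g\<close> agrees with \<open>f\<close> on \<open>F\<close>.\<close>
  define \<kappa> where "\<kappa> = f \<circ> inv_into UNIV g"
  have \<kappa>: "side_perm U V \<kappa>"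
    unfolding \<kappa>_def using f gp side_perm_inv side_perm_comp by blast
  have "\<exists>k\<in>G. (\<forall>x\<in>g ` F. k x = \<kappa> x) \<and> (\<forall>a\<in>U. \<forall>b\<in>V. M (k a) (k b) = M a b)"
  proof (rule ex_aut)
    show "inj_on \<kappa> (g ` F)"
      using \<kappa> by (metis bij_is_inj inj_on_subset side_perm_def top_greatest)
    show "g ` F \<subseteq> U \<union> V"
      using F gp by (auto simp: side_perm_mem)
    show "M (\<kappa> a) (\<kappa> b) = M a b" if "a \<in> g ` F \<inter> U" "b \<in> g ` F \<inter> V" for a b
    proof -
      obtain a' b' where "a = g a'" "b = g b'" "a' \<in> F \<inter> U" "b' \<in> F \<inter> V"
        using \<open>a \<in> g ` F \<inter> U\<close> \<open>b \<in> g ` F \<inter> V\<close> side_perm_mem[OF gp] by auto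
      then show ?thesis
        using g(2) gi by (simp add: \<kappa>_def)
    qed
  qed (use F \<kappa> in \<open>auto simp: side_perm_mem\<close>)
  then obtain k where k: "k \<in> G" "\<forall>x\<in>g ` F. k x = \<kappa> x"
    by blast
  then have "k \<circ> g \<in> G" "\<forall>x\<in>F. (k \<circ> g) x = f x"
    using g(1) gi comp by (auto simp: \<kappa>_def)
  then show "\<exists>g\<in>G. \<forall>x\<in>F. g x = f x" by blast
qed

text \<open>\<open>B\<close> is fixed exactly, the columns outside \<open>B\<close> are left free,
  and no single element is asked to act as the transposition on all rows.\<close>

definition exch :: "'v set \<Rightarrow> 'v \<Rightarrow> 'v \<Rightarrow> bool" where
  "exch B a a' \<longleftrightarrow> (\<forall>A. finite A \<longrightarrow> A \<subseteq> U \<longrightarrow>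
     (\<exists>g\<in>G. (\<forall>b\<in>B. g b = b) \<and> (\<forall>x\<in>A. g x = transpose a a' x)))"

lemma exchE:
  assumes "exch B a a'" "finite A" "A \<subseteq> U"
  obtains g where "g \<in> G" "\<forall>b\<in>B. g b = b" "\<forall>x\<in>A. g x = transpose a a' x"
  using assms unfolding exch_def by blast

text \<open>Together with the identity on \<open>B\<close> the transposition is a finite partial
  automorphism, because the two rows look alike from \<open>B\<close>.\<close>

lemma exch_same_type:
  assumes B: "finite B" "B \<subseteq> V" and a: "a \<in> U" "a' \<in> U" and eq: "\<And>b. b \<in> B \<Longrightarrow> M a b = M a' b"
  shows "exch B a a'"
  unfolding exch_def
proof (intro allI impI)
  fix A assume A: "finite A" "A \<subseteq> U"
  have fixB: "transpose a a' b = b" if "b \<in> V" for b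
    using that a disj by (metis disjoint_iff transpose_apply_other)
  have "\<exists>k\<in>G. (\<forall>x\<in>A \<union> B. k x = transpose a a' x) \<and> (\<forall>a\<in>U. \<forall>b\<in>V. M (k a) (k b) = M a b)"
  proof (rule ex_aut)
    show "transpose a a' ` ((A \<union> B) \<inter> U) \<subseteq> U"
      using a by (auto simp: transpose_def)
    show "transpose a a' ` ((A \<union> B) \<inter> V) \<subseteq> V"
      using fixB by auto
    fix c b assume c: "c \<in> (A \<union> B) \<inter> U" "b \<in> (A \<union> B) \<inter> V"
    then have "b \<in> B" "b \<in> V"
      using A(2) disj by auto
    then show "M (transpose a a' c) (transpose a a' b) = M c b"
      using fixB eq by (auto simp: transpose_def)
  qed (use A B in auto)
  then show "\<exists>g\<in>G. (\<forall>b\<in>B. g b = b) \<and> (\<forall>x\<in>A. g x = transpose a a' x)"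
    using fixB B(2) by (metis Un_iff subsetD)
qed

lemma exch_commute: "exch B a a' \<longleftrightarrow> exch B a' a"
  unfolding exch_def by (simp add: transpose_commute)

lemma exch_refl: "exch B a a"
  unfolding exch_def using id_mem by (auto intro!: bexI[of _ id])

text \<open>Uses \<open>(a c) = (a b) (b c) (a b)\<close>, valid when \<open>c\<close> differs from
  \<open>a\<close> and \<open>b\<close>. The three elements are picked one after the other, since
  each must act correctly on the rows already moved.\<close>

lemma exch_trans:
  assumes "exch B a b" "exch B b c" "a \<in> U" "b \<in> U"
  shows "exch B a c"
proof (cases "a = c \<or> b = c")
  case True
  then show ?thesis using assms exch_refl by auto
next
  case False
  show ?thesis
    unfolding exch_def
  proof (intro allI impI)
    fix A assume A: "finite A" "A \<subseteq> U"
    obtain g1 where g1: "g1 \<in> G" "\<forall>b\<in>B. g1 b = b" "\<forall>x\<in>A. g1 x = transpose a b x"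
      using exchE[OF assms(1) A] .
    have A1: "finite (g1 ` A)" "g1 ` A \<subseteq> U"
      using A side_perm_mem[OF perm[OF g1(1)]] by auto
    obtain g2 where g2: "g2 \<in> G" "\<forall>b\<in>B. g2 b = b" "\<forall>x\<in>g1 ` A. g2 x = transpose b c x"
      using exchE[OF assms(2) A1] .
    have A2: "finite (g2 ` g1 ` A)" "g2 ` g1 ` A \<subseteq> U"
      using A side_perm_mem[OF perm[OF g1(1)]] side_perm_mem[OF perm[OF g2(1)]] by auto
    obtain g3 where g3: "g3 \<in> G" "\<forall>b\<in>B. g3 b = b" "\<forall>x\<in>g2 ` g1 ` A. g3 x = transpose a b x"
      using exchE[OF assms(1) A2] .
    have "g3 \<circ> (g2 \<circ> g1) \<in> G"
      using g1(1) g2(1) g3(1) comp by blast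
    moreover have "(g3 \<circ> (g2 \<circ> g1)) x = transpose a c x" if "x \<in> A" for x
      using that g1(3) g2(3) g3(3) transpose_triple[of a c b x] False by simp
    ultimately show "\<exists>g\<in>G. (\<forall>b\<in>B. g b = b) \<and> (\<forall>x\<in>A. g x = transpose a c x)"
      using g1(2) g2(2) g3(2) by (intro bexI[of _ "g3 \<circ> (g2 \<circ> g1)"]) auto
  qed
qed

text \<open>Conjugation by \<open>g\<close> takes the stabiliser of \<open>B\<close> to that of its
  image, and the transposition of \<open>a\<close> and \<open>a'\<close> to that of
  \<open>g a\<close> and \<open>g a'\<close>.\<close>

lemma exch_image:
  assumes g: "g \<in> G" and e: "exch B a a'"
  shows "exch (g ` B) (g a) (g a')"
  unfolding exch_def
proof (intro allI impI)
  fix A assume A: "finite A" "A \<subseteq> U"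
  let ?i = "inv_into UNIV g"
  note gi = side_perm_inv_simps[OF perm[OF g]]
  have A': "finite (?i ` A)" "?i ` A \<subseteq> U"
    using A side_perm_mem[OF perm[OF invs[OF g]]] by auto
  obtain h where h: "h \<in> G" "\<forall>b\<in>B. h b = b" "\<forall>x\<in>?i ` A. h x = transpose a a' x"
    using exchE[OF e A'] .
  have "g \<circ> (h \<circ> ?i) \<in> G"
    using g h(1) invs comp by blast
  moreover have "(g \<circ> (h \<circ> ?i)) b = b" if "b \<in> g ` B" for b
    using that h(2) gi by auto
  moreover have "(g \<circ> (h \<circ> ?i)) x = transpose (g a) (g a') x" if "x \<in> A" for x
  proof -
    have "(g \<circ> (h \<circ> ?i)) x = g (transpose a a' (?i x))"
      using that h(3) by simp
    also have "\<dots> = transpose (g a) (g a') (g (?i x))"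
      using gi(1) by (metis transpose_def)
    finally show ?thesis using gi by simp
  qed
  ultimately show "\<exists>h\<in>G. (\<forall>b\<in>g ` B. h b = b) \<and> (\<forall>x\<in>A. h x = transpose (g a) (g a') x)"
    by (intro bexI[of _ "g \<circ> (h \<circ> ?i)"] conjI ballI)
qed

lemma exch_image_iff:
  assumes g: "g \<in> G"
  shows "exch (g ` B) (g a) (g a') \<longleftrightarrow> exch B a a'"
proof
  assume "exch (g ` B) (g a) (g a')"
  from exch_image[OF invs[OF g] this] show "exch B a a'"
    using side_perm_inv_simps[OF perm[OF g]] by (simp add: image_image)
qed (rule exch_image[OF g])

section \<open>Column sets over which all rows are exchangeable\<close>

definition all_exch :: "'v set \<Rightarrow> bool" where
  "all_exch B \<longleftrightarrow> (\<forall>a\<in>U. \<forall>a'\<in>U. exch B a a')"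

text \<open>Built up by transpositions: a new row \<open>x\<close> is carried along to
  \<open>g x\<close> and then swapped with \<open>h x\<close>, which disturbs no earlier
  \<open>h y\<close>.\<close>

lemma all_exch_extend:
  assumes B: "all_exch B" and A: "finite A" "A \<subseteq> U" "inj_on h A" "h ` A \<subseteq> U"
  shows "\<exists>g\<in>G. (\<forall>b\<in>B. g b = b) \<and> (\<forall>x\<in>A. g x = h x)"
  using A
proof (induction A)
  case empty
  then show ?case using id_mem by (intro bexI[of _ id]) simp_all
next
  case (insert x A)
  then obtain g where g: "g \<in> G" "\<forall>b\<in>B. g b = b" "\<forall>x\<in>A. g x = h x"
    by auto
  have x: "g x \<in> U" "h x \<in> U"
    using insert.prems side_perm_mem[OF perm[OF g(1)]] by auto
  have e: "exch B (g x) (h x)"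
    using x B by (simp add: all_exch_def)
  have A': "finite (g ` insert x A)" "g ` insert x A \<subseteq> U"
    using insert.prems insert.hyps side_perm_mem[OF perm[OF g(1)]] by auto
  obtain t where t: "t \<in> G" "\<forall>b\<in>B. t b = b"
    "\<forall>y\<in>g ` insert x A. t y = transpose (g x) (h x) y"
    using exchE[OF e A'] .
  have "t (g y) = h y" if "y \<in> A" for y
  proof -
    have "inj g"
      using perm[OF g(1)] by (simp add: side_perm_def bij_is_inj)
    moreover have "y \<noteq> x"
      using that insert.hyps by blast
    ultimately have "g y \<noteq> g x" "h y \<noteq> h x"
      using that inj_on_eq_iff[OF insert.prems(2), of y x] by (auto simp: inj_eq)
    then show ?thesis
      using t(3) g(3) that by simp
  qed
  moreover have "t (g x) = h x"
    using t(3) by simp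
  ultimately show ?case
    using comp[OF t(1) g(1)] t(2) g(2) by (intro bexI[of _ "t \<circ> g"]) auto
qed

text \<open>A map defined on columns only has no entries to preserve, so every bijection of finite
  column sets is a partial automorphism. Hence \<open>all_exch\<close> depends only on the size of
  the column set.\<close>

lemma col_set_move:
  assumes "finite B" "B \<subseteq> V" "finite C" "C \<subseteq> V" "card B = card C"
  shows "\<exists>g\<in>G. g ` B = C"
proof -
  obtain \<kappa> where \<kappa>: "bij_betw \<kappa> B C"
    using assms(1,3,5) finite_same_card_bij by blast
  have "\<exists>k\<in>G. (\<forall>x\<in>B. k x = \<kappa> x) \<and> (\<forall>a\<in>U. \<forall>b\<in>V. M (k a) (k b) = M a b)"
    using \<kappa> assms disj by (intro ex_aut) (auto simp: bij_betw_def)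
  then show ?thesis
    using \<kappa> by (metis bij_betw_imp_surj_on image_cong)
qed

lemma all_exch_transfer:
  assumes "finite B" "B \<subseteq> V" "finite C" "C \<subseteq> V" "card B = card C" "all_exch B"
  shows "all_exch C"
  unfolding all_exch_def
proof (intro ballI)
  fix a a' assume a: "a \<in> U" "a' \<in> U"
  obtain g where g: "g \<in> G" "g ` C = B"
    using col_set_move[OF assms(3,4,1,2)] assms(5) by auto
  have "g a \<in> U" "g a' \<in> U"
    using a side_perm_mem[OF perm[OF g(1)]] by auto
  then have "exch (g ` C) (g a) (g a')"
    using assms(6) g(2) by (simp add: all_exch_def)
  then show "exch C a a'"
    using exch_image_iff[OF g(1)] by blast
qed

end

section \<open>The parity dichotomy\<close>

context bip_group
begin

definition all_exch_card :: "nat \<Rightarrow> bool" where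
  "all_exch_card n \<longleftrightarrow> (\<forall>B. finite B \<longrightarrow> B \<subseteq> V \<longrightarrow> card B = n \<longrightarrow> all_exch B)"

lemma all_exch_cardD: "all_exch_card (card B) \<Longrightarrow> finite B \<Longrightarrow> B \<subseteq> V \<Longrightarrow> all_exch B"
  unfolding all_exch_card_def by blast

lemma all_exch_cardI: "all_exch B \<Longrightarrow> finite B \<Longrightarrow> B \<subseteq> V \<Longrightarrow> all_exch_card (card B)"
  unfolding all_exch_card_def using all_exch_transfer by metis

lemma all_exch_card_0: "all_exch_card 0"
  unfolding all_exch_card_def all_exch_def by (auto intro: exch_same_type)

text \<open>The element \<open>g\<close> fixes \<open>B\<close> but carries \<open>b\<close> to an
  unknown column \<open>g b\<close>. The three images agree over \<open>B\<close>, and their entries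
  at \<open>g b\<close> take only two values, so two of them agree over the whole image of
  \<open>insert b B\<close>.\<close>

lemma two_classes:
  assumes B: "finite B" "B \<subseteq> V" "all_exch B" and b: "b \<in> V" and a: "a1 \<in> U" "a2 \<in> U" "a3 \<in> U"
  shows "exch (insert b B) a1 a2 \<or> exch (insert b B) a1 a3 \<or> exch (insert b B) a2 a3"
proof -
  obtain h where h: "inj_on h {a1, a2, a3}" "\<forall>a\<in>{a1, a2, a3}. h a \<in> {u\<in>U. \<forall>y\<in>B. M u y = True}"
    using inj_choice[of "{a1, a2, a3}" "\<lambda>_. {u\<in>U. \<forall>y\<in>B. M u y = True}"]
      infinite_row_type[OF B(1,2), of "\<lambda>_. True"] by auto
  obtain g where g: "g \<in> G" "\<forall>b\<in>B. g b = b" "\<forall>x\<in>{a1, a2, a3}. g x = h x"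
    using all_exch_extend[OF B(3) _ _ h(1)] h(2) a by auto
  have img: "g ` insert b B = insert (g b) B"
    using g(2) by auto
  have gb: "finite (insert (g b) B)" "insert (g b) B \<subseteq> V"
    using B b side_perm_mem[OF perm[OF g(1)]] by auto
  have *: "exch (insert b B) x y"
    if "x \<in> {a1, a2, a3}" "y \<in> {a1, a2, a3}" "M (h x) (g b) = M (h y) (g b)" for x y
  proof -
    have "exch (insert (g b) B) (h x) (h y)"
      using h(2) that by (intro exch_same_type[OF gb]) auto
    moreover have "g x = h x" "g y = h y"
      using g(3) that(1,2) by blast+
    ultimately show ?thesis
      using exch_image_iff[OF g(1), of "insert b B" x y] unfolding img by simp
  qed
  have "M (h a1) (g b) = M (h a2) (g b) \<or> M (h a1) (g b) = M (h a3) (g b)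
      \<or> M (h a2) (g b) = M (h a3) (g b)"
    by blast
  then show ?thesis
    using * by blast
qed

text \<open>An arbitrary pair of rows can be moved onto the given pair with \<open>B\<close> fixed,
  and only the image column \<open>g b\<close> is unknown. There the given rows either agree, or
  differ as they do at \<open>b\<close> up to interchanging them.\<close>

lemma exch_flip_imp_all_exch:
  assumes B: "finite B" "B \<subseteq> V" "all_exch B" and b: "b \<in> V" "b \<notin> B"
    and a: "a1 \<in> U" "a2 \<in> U"
    and eq: "\<And>c. c \<in> B \<Longrightarrow> M a1 c = M a2 c" and neq: "M a1 b \<noteq> M a2 b"
    and e: "exch (insert b B) a1 a2"
  shows "all_exch (insert b B)"
  unfolding all_exch_def
proof (intro ballI)
  fix c1 c2 assume c: "c1 \<in> U" "c2 \<in> U"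
  have a12: "a1 \<noteq> a2" using neq by auto
  show "exch (insert b B) c1 c2"
  proof (cases "c1 = c2")
    case True
    then show ?thesis by (simp add: exch_refl)
  next
    case False
    define h where "h x = (if x = c1 then a1 else a2)" for x
    have "inj_on h {c1, c2}" "h ` {c1, c2} \<subseteq> U"
      using a12 a by (auto simp: h_def inj_on_def)
    then obtain g where g: "g \<in> G" "\<forall>b\<in>B. g b = b" "\<forall>x\<in>{c1, c2}. g x = h x"
      using all_exch_extend[OF B(3), of "{c1, c2}" h] c by auto
    have gc: "g c1 = a1" "g c2 = a2"
      using g(3) False by (auto simp: h_def)
    have img: "g ` insert b B = insert (g b) B"
      using g(2) by auto
    have gbV: "g b \<in> V"
      using b(1) side_perm_mem[OF perm[OF g(1)]] by simp
    have "inj g"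
      using perm[OF g(1)] by (simp add: side_perm_def bij_is_inj)
    then have gbB: "g b \<notin> B"
      using b(2) g(2) by (metis injD)
    have "exch (insert (g b) B) a1 a2"
    proof (cases "M a1 (g b) = M a2 (g b)")
      case True
      then show ?thesis
        using eq a B(1,2) gbV by (intro exch_same_type) auto
    next
      case neq': False
      \<comment> \<open>If the entries at \<open>g b\<close> are those at \<open>b\<close> with the
        rows interchanged, the map has to swap \<open>a1\<close> and \<open>a2\<close>; symmetry of
        \<open>exch\<close> absorbs the swap.\<close>
      define \<tau> where "\<tau> = (if M a1 (g b) = M a1 b then id else transpose a1 a2)"
      define \<kappa> where "\<kappa> = \<tau>(b := g b)"
      have V: "a1 \<notin> V" "a2 \<notin> V" "b \<notin> U"
        using a b(1) disj by auto
      then have ab: "a1 \<noteq> b" "a2 \<noteq> b" "a1 \<notin> B" "a2 \<notin> B"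
        using b(1) B(2) by auto
      have \<tau>B: "\<tau> x = x" if "x \<in> B" for x
        using that ab by (auto simp: \<tau>_def transpose_def)
      have \<kappa>B: "\<kappa> x = x" if "x \<in> B" for x
        using that \<tau>B b(2) by (auto simp: \<kappa>_def)
      have \<kappa>b: "\<kappa> b = g b"
        by (simp add: \<kappa>_def)
      have \<kappa>a: "\<kappa> a1 = \<tau> a1" "\<kappa> a2 = \<tau> a2" "\<kappa> a1 = a1 \<and> \<kappa> a2 = a2 \<or> \<kappa> a1 = a2 \<and> \<kappa> a2 = a1"
        using ab by (auto simp: \<kappa>_def \<tau>_def)
      have FU: "({a1, a2} \<union> insert b B) \<inter> U = {a1, a2}"
        and FV: "({a1, a2} \<union> insert b B) \<inter> V = insert b B"
        using a b(1) B(2) disj by auto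
      have "\<exists>k\<in>G. (\<forall>x\<in>{a1, a2} \<union> insert b B. k x = \<kappa> x) \<and> (\<forall>a\<in>U. \<forall>b\<in>V. M (k a) (k b) = M a b)"
      proof (rule ex_aut)
        have "inj_on \<kappa> {a1, a2}"
          using \<kappa>a a12 by auto
        moreover have "inj_on \<kappa> (insert b B)"
          using \<kappa>B \<kappa>b gbB by (auto simp: inj_on_def)
        moreover have "\<kappa> ` {a1, a2} \<subseteq> U" "\<kappa> ` insert b B \<subseteq> V"
          using \<kappa>a(3) a \<kappa>B \<kappa>b gbV B(2) by auto
        ultimately show "inj_on \<kappa> ({a1, a2} \<union> insert b B)"
          using disj unfolding inj_on_Un by blast
        show "\<kappa> ` (({a1, a2} \<union> insert b B) \<inter> U) \<subseteq> U"
          unfolding FU using \<kappa>a(3) a by auto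
        show "\<kappa> ` (({a1, a2} \<union> insert b B) \<inter> V) \<subseteq> V"
          unfolding FV using \<kappa>B \<kappa>b gbV B(2) by auto
        fix x y
        assume "x \<in> ({a1, a2} \<union> insert b B) \<inter> U" "y \<in> ({a1, a2} \<union> insert b B) \<inter> V"
        then have xy: "x = a1 \<or> x = a2" "y = b \<or> y \<in> B"
          unfolding FU FV by auto
        show "M (\<kappa> x) (\<kappa> y) = M x y"
        proof (cases "y = b")
          case True
          then show ?thesis
            using xy(1) neq neq' \<kappa>a(1,2) \<kappa>b by (auto simp: \<tau>_def)
        next
          case False
          then show ?thesis
            using xy \<kappa>a(3) \<kappa>B eq by auto
        qed
      qed (use a b(1) B in auto)
      then obtain k where k: "k \<in> G" "\<forall>x\<in>{a1, a2} \<union> insert b B. k x = \<kappa> x"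
        by blast
      have "k ` insert b B = insert (g b) B"
        using k(2) \<kappa>B \<kappa>b by auto
      then have "exch (insert (g b) B) (k a1) (k a2)"
        using exch_image[OF k(1) e] by simp
      then show ?thesis
        using k(2) \<kappa>a(3) exch_commute[of _ a1 a2] by auto
    qed
    then show ?thesis
      using exch_image_iff[OF g(1), of "insert b B" c1 c2] img gc by simp
  qed
qed

lemma exch_iff_even:
  assumes n: "all_exch_card n" "\<not> all_exch_card (Suc n)"
    and B: "finite B" "B \<subseteq> V" "card B = Suc n" and a: "a \<in> U" "a' \<in> U"
  shows "exch B a a' \<longleftrightarrow> even (card {b\<in>B. M a b \<noteq> M a' b})"
proof -
  have "exch B a a' \<longleftrightarrow> even (card D)"
    if "finite D" "{b\<in>B. M a b \<noteq> M a' b} = D" "a \<in> U" "a' \<in> U" for D a a'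
    using that
  proof (induction D arbitrary: a a')
    case empty
    then have "exch B a a'"
      using B by (intro exch_same_type) auto
    then show ?case by simp
  next
    case (insert b D)
    have b: "b \<in> B" "b \<in> V" "M a b \<noteq> M a' b"
      using insert.prems(1) B by blast+
    \<comment> \<open>\<open>a''\<close> interpolates: it differs from \<open>a\<close> exactly on
      \<open>D\<close> and from \<open>a'\<close> only at \<open>b\<close>. The latter pair is not
      exchangeable, so, there being two classes, \<open>a\<close> is exchangeable with exactly one
      of \<open>a'\<close> and \<open>a''\<close>.\<close>
    obtain a'' where a'': "a'' \<in> U" "\<forall>y\<in>B. M a'' y = (if y = b then M a b else M a' y)"
      using ext_row[OF B(1,2), of "\<lambda>y. if y = b then M a b else M a' y"] by blast
    have "{c\<in>B. M a c \<noteq> M a'' c} = {c\<in>B. M a c \<noteq> M a' c} - {b}"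
    proof (rule Set.set_eqI)
      show "c \<in> {c\<in>B. M a c \<noteq> M a'' c} \<longleftrightarrow> c \<in> {c\<in>B. M a c \<noteq> M a' c} - {b}" for c
        using a''(2) by (cases "c = b"; cases "c \<in> B") simp_all
    qed
    also have "\<dots> = D"
      unfolding insert.prems(1) using insert.hyps(2) by simp
    finally have "{c\<in>B. M a c \<noteq> M a'' c} = D" .
    then have IH: "exch B a a'' \<longleftrightarrow> even (card D)"
      using insert.IH insert.prems(2) a''(1) by blast
    define C where "C = B - {b}"
    have C: "finite C" "C \<subseteq> V" "card C = n" "insert b C = B" "b \<notin> C"
      using B b by (auto simp: C_def)
    have allC: "all_exch C"
      using n(1) C all_exch_cardD by blast
    have "\<not> all_exch B"
      using n(2) all_exch_cardI[OF _ B(1,2)] B(3) by auto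
    then have not: "\<not> exch B a'' a'"
      using exch_flip_imp_all_exch[OF C(1,2) allC b(2) C(5), of a'' a'] a'' insert.prems(3) b C(4)
      by (auto simp: C_def)
    have "exch B a a'' \<or> exch B a a' \<or> exch B a'' a'"
      using two_classes[OF C(1,2) allC b(2), of a a'' a'] C(4) insert.prems a''(1) by simp
    moreover have "\<not> (exch B a a'' \<and> exch B a a')"
      using not exch_trans[of B a'' a a'] exch_commute insert.prems a''(1) by blast
    ultimately show ?case
      using IH not insert.hyps by auto
  qed
  then show ?thesis
    using B(1) a by simp
qed

text \<open>\<open>g\<close> transports exchangeability to the image of \<open>B\<close>, which has
  the same size, and with it the parity that describes exchangeability.\<close>

lemma even_dist_invariant:
  assumes n: "all_exch_card n" "\<not> all_exch_card (Suc n)"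
    and B: "finite B" "B \<subseteq> V" "card B = Suc n" and a: "a \<in> U" "a' \<in> U" and g: "g \<in> G"
  shows "even (card {b\<in>B. M (g a) (g b) \<noteq> M (g a') (g b)}) \<longleftrightarrow> even (card {b\<in>B. M a b \<noteq> M a' b})"
proof -
  note mem = side_perm_mem[OF perm[OF g]]
  have inj: "inj_on g X" for X
    using perm[OF g] by (metis bij_is_inj inj_on_subset side_perm_def top_greatest)
  have "finite (g ` B)" "g ` B \<subseteq> V" "card (g ` B) = Suc n" "g a \<in> U" "g a' \<in> U"
    using B a mem by (auto simp: card_image[OF inj])
  note * = exch_iff_even[OF n this]
  have "{c\<in>g ` B. M (g a) c \<noteq> M (g a') c} = g ` {b\<in>B. M (g a) (g b) \<noteq> M (g a') (g b)}"
    by auto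
  then have "card {c\<in>g ` B. M (g a) c \<noteq> M (g a') c} = card {b\<in>B. M (g a) (g b) \<noteq> M (g a') (g b)}"
    by (simp add: card_image[OF inj])
  then show ?thesis
    using * exch_iff_even[OF n B a] exch_image_iff[OF g] by simp
qed

text \<open>The nested equations between truth values express that the sum modulo 2 of the four
  changes in a rectangle is zero.\<close>

definition rect_invariant :: bool where
  "rect_invariant \<longleftrightarrow> (\<forall>g\<in>G. \<forall>a\<in>U. \<forall>a'\<in>U. \<forall>b\<in>V. \<forall>b'\<in>V.
     ((M (g a) (g b) \<noteq> M a b) = (M (g a') (g b) \<noteq> M a' b)) =
     ((M (g a) (g b') \<noteq> M a b') = (M (g a') (g b') \<noteq> M a' b')))"

lemma even_card_insert:
  assumes "finite C" "b \<notin> C"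
  shows "even (card {x\<in>insert b C. P x}) \<longleftrightarrow> (P b \<longleftrightarrow> odd (card {x\<in>C. P x}))"
proof (cases "P b")
  case True
  then have "{x\<in>insert b C. P x} = insert b {x\<in>C. P x}" by auto
  then show ?thesis using assms True by simp
next
  case False
  then have "{x\<in>insert b C. P x} = {x\<in>C. P x}" by auto
  then show ?thesis using False by simp
qed

text \<open>The invariant for \<open>n + 1\<close> columns is applied to \<open>insert b C\<close>
  and \<open>insert b' C\<close> with the same \<open>n\<close> further columns; the contributions
  of \<open>C\<close> cancel.\<close>

lemma rect_invariant_if:
  assumes n: "all_exch_card n" "\<not> all_exch_card (Suc n)"
  shows rect_invariant
  unfolding rect_invariant_def
proof (intro ballI)
  fix g a a' b b'
  assume g: "g \<in> G" and a: "a \<in> U" "a' \<in> U" and b: "b \<in> V" "b' \<in> V"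
  have inf: "infinite (V - {b, b'})"
    using infinite_col by simp
  obtain C where C: "finite C" "card C = n" "C \<subseteq> V - {b, b'}"
    using infinite_arbitrarily_large[OF inf, of n] by blast
  let ?P = "\<lambda>x. M a x \<noteq> M a' x" and ?Q = "\<lambda>x. M (g a) (g x) \<noteq> M (g a') (g x)"
  have "(?Q c \<longleftrightarrow> odd (card {x\<in>C. ?Q x})) = (?P c \<longleftrightarrow> odd (card {x\<in>C. ?P x}))"
    if "c = b \<or> c = b'" for c
  proof -
    have c: "c \<notin> C" "c \<in> V"
      using C that b by auto
    show ?thesis
      using even_dist_invariant[OF n, of "insert c C" a a' g] C c a g
        even_card_insert[OF C(1) c(1), of ?P] even_card_insert[OF C(1) c(1), of ?Q] by auto
  qed
  from this[of b] this[of b'] show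
    "((M (g a) (g b) \<noteq> M a b) = (M (g a') (g b) \<noteq> M a' b)) =
     ((M (g a) (g b') \<noteq> M a b') = (M (g a') (g b') \<noteq> M a' b'))"
    by argo
qed

text \<open>An automorphism \<open>k\<close> matches \<open>f\<close> on the columns of
  \<open>F\<close>, where no rows constrain it. An element fixing these columns and applied before
  \<open>k\<close> then adjusts the rows.\<close>

lemma side_perm_mem_if_all_exch:
  assumes all: "\<And>n. all_exch_card n" and f: "side_perm U V f"
  shows "f \<in> G"
proof (rule closed[OF f])
  fix F assume F: "finite F" "F \<subseteq> U \<union> V"
  have injf: "inj_on f X" for X
    using f by (metis bij_is_inj inj_on_subset side_perm_def top_greatest)
  have "\<exists>k\<in>G. (\<forall>x\<in>F \<inter> V. k x = f x) \<and> (\<forall>a\<in>U. \<forall>b\<in>V. M (k a) (k b) = M a b)"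
    using F f disj by (intro ex_aut injf) (auto simp: side_perm_mem)
  then obtain k where k: "k \<in> G" "\<forall>x\<in>F \<inter> V. k x = f x"
    by blast
  define h where "h = inv_into UNIV k \<circ> f"
  have h: "side_perm U V h"
    unfolding h_def using perm[OF invs[OF k(1)]] f side_perm_comp by blast
  have "all_exch (F \<inter> V)"
    using all all_exch_cardD F by simp
  moreover have "inj_on h (F \<inter> U)"
    using h by (metis bij_is_inj inj_on_subset side_perm_def top_greatest)
  moreover have "h ` (F \<inter> U) \<subseteq> U"
    using h by (auto simp: side_perm_mem)
  ultimately obtain g where g: "g \<in> G" "\<forall>b\<in>F \<inter> V. g b = b" "\<forall>x\<in>F \<inter> U. g x = h x"
    using all_exch_extend[of "F \<inter> V" "F \<inter> U" h] F by auto
  have "(k \<circ> g) x = f x" if "x \<in> F" for x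
  proof (cases "x \<in> V")
    case True
    then show ?thesis using g(2) k(2) that by simp
  next
    case False
    then have "x \<in> F \<inter> U" using that F(2) by auto
    then show ?thesis
      using g(3) side_perm_inv_simps[OF perm[OF k(1)]] by (simp add: h_def)
  qed
  then show "\<exists>g\<in>G. \<forall>x\<in>F. g x = f x"
    using comp[OF k(1) g(1)] by blast
qed

lemma rect_invariant_if_proper:
  assumes "side_perm U V f" "f \<notin> G"
  shows rect_invariant
proof (rule ccontr)
  assume "\<not> rect_invariant"
  then have "all_exch_card n \<Longrightarrow> all_exch_card (Suc n)" for n
    using rect_invariant_if by blast
  then have "all_exch_card n" for n
    by (induction n) (use all_exch_card_0 in auto)
  then show False
    using side_perm_mem_if_all_exch assms by blast
qed

text \<open>For a single column the parity of the distance records whether two entries are equal;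
  preserving this means changing both entries or neither.\<close>

lemma flip_row_independent:
  assumes n: "\<not> all_exch_card 1" and g: "g \<in> G" and a: "a \<in> U" "a' \<in> U" and b: "b \<in> V"
  shows "(M (g a) (g b) \<noteq> M a b) = (M (g a') (g b) \<noteq> M a' b)"
  using even_dist_invariant[OF all_exch_card_0, of "{b}" a a' g]
    even_card_insert[of "{}" b "\<lambda>x. M a x \<noteq> M a' x"]
    even_card_insert[of "{}" b "\<lambda>x. M (g a) (g x) \<noteq> M (g a') (g x)"] n g a b by auto

end

section \<open>Realising switches\<close>

context bip_group
begin

lemma rect_invariantD:
  assumes rect_invariant "g \<in> G" "a \<in> U" "a' \<in> U" "b \<in> V" "b' \<in> V"
  shows "((M (g a) (g b) \<noteq> M a b) = (M (g a') (g b) \<noteq> M a' b)) =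
     ((M (g a) (g b') \<noteq> M a b') = (M (g a') (g b') \<noteq> M a' b'))"
  using assms(1)[unfolded rect_invariant_def, rule_format, OF assms(2-6)] .

lemma rect_invariant_dual:
  assumes rect_invariant
  shows "bip_group.rect_invariant V U (\<lambda>b a. M a b) G"
  unfolding bip_group.rect_invariant_def[OF dual_group]
proof (intro ballI)
  fix g b b' a a' assume "g \<in> G" "b \<in> V" "b' \<in> V" "a \<in> U" "a' \<in> U"
  from rect_invariantD[OF assms this(1) this(4,5,2,3)] show
    "((M (g a) (g b) \<noteq> M a b) = (M (g a) (g b') \<noteq> M a b')) =
     ((M (g a') (g b) \<noteq> M a' b) = (M (g a') (g b') \<noteq> M a' b'))"
    by argo
qed

text \<open>An element of \<open>G\<close> that acts on one row as prescribed by \<open>w\<close> acts as \<open>w\<close> up to flipping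
  some rows.  With two disjoint copies of the columns \<open>B\<close>, the pigeonhole principle yields a copy
  of every finite pattern on whose rows the unwanted flips are constant.\<close>

lemma col_switch_mem:
  assumes rect: rect_invariant and cols: "bip_group.all_exch_card V U G 1"
    and s: "side_perm U V s" "\<And>a b. a \<in> U \<Longrightarrow> b \<in> V \<Longrightarrow> M (s a) (s b) = (M a b \<noteq> w b)"
  shows "s \<in> G"
proof (rule local_mem[OF s(1)])
  fix A B assume A: "finite A" "A \<subseteq> U" and B: "finite B" "B \<subseteq> V"
  interpret D: bip_group V U "\<lambda>b a. M a b" G \<rho> by (rule dual_group)
  obtain a0 where a0: "a0 \<in> U"
    using infinite_row infinite_imp_nonempty by blast
  obtain c0 where c0: "c0 \<in> V"
    using infinite_col infinite_imp_nonempty by blast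
  \<comment> \<open>A second copy of \<open>B\<close>, disjoint from it, on which the entries of a
    row can be prescribed independently; \<open>w'\<close> repeats \<open>w\<close> there.\<close>
  have "infinite (V - B)"
    using infinite_col B by simp
  then obtain \<beta> where \<beta>: "inj_on \<beta> B" "\<forall>b\<in>B. \<beta> b \<in> V - B"
    using inj_choice[OF B(1), of "\<lambda>_. V - B"] by auto
  define C where "C = B \<union> \<beta> ` B"
  have C: "finite C" "C \<subseteq> V"
    using B \<beta> by (auto simp: C_def)
  define w' where "w' c = (if c \<in> B then w c else w (the_inv_into B \<beta> c))" for c
  have w'1: "w' b = w b" and w'2: "w' (\<beta> b) = w b" if "b \<in> B" for b
    using that \<beta> by (auto simp: w'_def the_inv_into_f_f)
  \<comment> \<open>\<open>S c\<close> collects the columns whose entry in row \<open>a0\<close> is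
    that of \<open>c\<close> after the intended change. An element fixing \<open>a0\<close> and
    mapping each \<open>c\<close> in \<open>C\<close> into \<open>S c\<close> thus changes row
    \<open>a0\<close> as \<open>w'\<close> prescribes.\<close>
  define S where "S c = {v\<in>V. \<forall>x\<in>{a0}. M x v = (M a0 c \<noteq> w' c)}" for c
  have "infinite (S c)" for c
    unfolding S_def by (rule infinite_col_type) (use a0 in auto)
  then have "\<exists>h. inj_on h C \<and> (\<forall>c\<in>C. h c \<in> S c)"
    by (intro inj_choice C(1))
  then obtain h where h: "inj_on h C" "\<forall>c\<in>C. h c \<in> S c" by blast
  have "D.all_exch {a0}"
    using D.all_exch_cardD[of "{a0}"] cols a0 by simp
  then obtain g where g: "g \<in> G" "g a0 = a0" "\<forall>c\<in>C. g c = h c"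
    using D.all_exch_extend[of "{a0}" C h] C h by (auto simp: S_def)
  have row0: "(M (g a0) (g c) \<noteq> M a0 c) = w' c" if "c \<in> C" for c
    using g h(2) that by (auto simp: S_def)
  \<comment> \<open>By rectangle parity the changes in rows \<open>a\<close> and \<open>a0\<close>
    differ by a constant, which is read off at the reference column \<open>c0\<close>.\<close>
  define u where "u a \<longleftrightarrow> ((M (g a) (g c0) \<noteq> M a c0) \<noteq> (M (g a0) (g c0) \<noteq> M a0 c0))" for a
  have g_eq: "M (g a) (g c) = ((M a c \<noteq> w' c) \<noteq> u a)" if "a \<in> U" "c \<in> C" for a c
    using rect_invariantD[OF rect g(1) that(1) a0 subsetD[OF C(2) that(2)] c0] row0[OF that(2)]
    unfolding u_def by argo
  define good where "good \<alpha> j e \<longleftrightarrow> inj_on \<alpha> A \<and> (\<forall>a\<in>A. \<alpha> a \<in> U \<and> u (\<alpha> a) = e \<and>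
    (\<forall>b\<in>B. M (\<alpha> a) (j b) = M a b))" for \<alpha> and j :: "'v \<Rightarrow> 'v" and e
  have "\<exists>\<alpha> j e. (j = id \<or> j = \<beta>) \<and> good \<alpha> j e"
  \<comment> \<open>If each row pattern of \<open>A\<close> on \<open>B\<close> occurs in infinitely
    many rows with \<open>u\<close> false, \<open>B\<close> itself serves. Otherwise this fails for
    some \<open>a1\<close>: all but finitely many rows with the pattern of \<open>a1\<close> on
    \<open>B\<close> have \<open>u\<close> true, and their entries on the second copy are still
    free.\<close>
  proof (cases "\<forall>a\<in>A. infinite {x\<in>U. (\<forall>b\<in>B. M x b = M a b) \<and> \<not> u x}")
    case True
    then obtain \<alpha> where \<alpha>: "inj_on \<alpha> A" "\<forall>a\<in>A. \<alpha> a \<in> {x\<in>U. (\<forall>b\<in>B. M x b = M a b) \<and> \<not> u x}"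
      using inj_choice[OF A(1), of "\<lambda>a. {x\<in>U. (\<forall>b\<in>B. M x b = M a b) \<and> \<not> u x}"] by auto
    have "good \<alpha> id False"
      using \<alpha> by (auto simp: good_def)
    then show ?thesis by blast
  next
    case False
    then obtain a1 where fin: "finite {x\<in>U. (\<forall>b\<in>B. M x b = M a1 b) \<and> \<not> u x}" by blast
    define T where "T a = {x\<in>U. \<forall>c\<in>C. M x c =
      (if c \<in> B then M a1 c else M a (the_inv_into B \<beta> c))}" for a
    have inf: "infinite (T a - {x\<in>U. (\<forall>b\<in>B. M x b = M a1 b) \<and> \<not> u x})" for a
      unfolding T_def using infinite_row_type[OF C, of "\<lambda>c. if c \<in> B then M a1 c else M a (the_inv_into B \<beta> c)"] fin
      by simp
    obtain \<alpha> where \<alpha>: "inj_on \<alpha> A"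
      "\<forall>a\<in>A. \<alpha> a \<in> T a - {x\<in>U. (\<forall>b\<in>B. M x b = M a1 b) \<and> \<not> u x}"
      using inj_choice[OF A(1), of "\<lambda>a. T a - {x\<in>U. (\<forall>b\<in>B. M x b = M a1 b) \<and> \<not> u x}"] inf by auto
    have "\<alpha> a \<in> U \<and> u (\<alpha> a) \<and> (\<forall>b\<in>B. M (\<alpha> a) (\<beta> b) = M a b)" if "a \<in> A" for a
    proof -
      have T: "\<alpha> a \<in> T a" and nu: "\<not> ((\<forall>b\<in>B. M (\<alpha> a) b = M a1 b) \<and> \<not> u (\<alpha> a))"
        using \<alpha>(2) that by (auto simp: T_def)
      have "\<forall>b\<in>B. M (\<alpha> a) b = M a1 b"
        using T by (simp add: T_def C_def)
      moreover have "M (\<alpha> a) (\<beta> b) = M a b" if "b \<in> B" for b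
      proof -
        have "\<beta> b \<in> C" "\<beta> b \<notin> B"
          using that \<beta>(2) by (auto simp: C_def)
        then show ?thesis
          using T that \<beta>(1) by (simp add: T_def the_inv_into_f_f)
      qed
      ultimately show ?thesis
        using nu T by (simp add: T_def)
    qed
    then have "good \<alpha> \<beta> True"
      using \<alpha>(1) by (simp add: good_def)
    then show ?thesis by blast
  qed
  then obtain \<alpha> j e where j: "j = id \<or> j = \<beta>" and "good \<alpha> j e" by blast
  then have \<alpha>: "inj_on \<alpha> A" "\<And>a. a \<in> A \<Longrightarrow> \<alpha> a \<in> U" "\<And>a. a \<in> A \<Longrightarrow> u (\<alpha> a) = e"
    "\<And>a b. a \<in> A \<Longrightarrow> b \<in> B \<Longrightarrow> M (\<alpha> a) (j b) = M a b"
    by (auto simp: good_def)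
  have jC: "j b \<in> C" "w' (j b) = w b" if "b \<in> B" for b
    using j that w'1 w'2 by (auto simp: C_def)
  have injj: "inj_on j B"
    using j \<beta>(1) by auto
  define \<kappa> where "\<kappa> x = (if x \<in> U then \<alpha> x else j x)" for x
  have \<kappa>A: "\<kappa> a = \<alpha> a" if "a \<in> A" for a
    using that A(2) by (auto simp: \<kappa>_def)
  have \<kappa>B: "\<kappa> b = j b" if "b \<in> B" for b
    using that B(2) disj by (auto simp: \<kappa>_def)
  have FU: "(A \<union> B) \<inter> U = A" and FV: "(A \<union> B) \<inter> V = B"
    using A(2) B(2) disj by auto
  have \<kappa>U: "\<kappa> ` A \<subseteq> U"
    using \<kappa>A \<alpha>(2) by auto
  have \<kappa>V: "\<kappa> ` B \<subseteq> V"
    using \<kappa>B jC(1) C(2) by auto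
  have "\<exists>k\<in>G. (\<forall>x\<in>A \<union> B. k x = \<kappa> x) \<and> (\<forall>a\<in>U. \<forall>b\<in>V. M (k a) (k b) = M a b)"
  proof (rule ex_aut)
    have "inj_on \<kappa> A" "inj_on \<kappa> B"
      using \<alpha>(1) injj \<kappa>A \<kappa>B by (simp_all cong: inj_on_cong)
    then show "inj_on \<kappa> (A \<union> B)"
      using \<kappa>U \<kappa>V disj unfolding inj_on_Un by blast
    show "\<kappa> ` ((A \<union> B) \<inter> U) \<subseteq> U" "\<kappa> ` ((A \<union> B) \<inter> V) \<subseteq> V"
      unfolding FU FV using \<kappa>U \<kappa>V by blast+
    show "M (\<kappa> a) (\<kappa> b) = M a b" if "a \<in> (A \<union> B) \<inter> U" "b \<in> (A \<union> B) \<inter> V" for a b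
      using that \<alpha>(4) unfolding FU FV by (simp add: \<kappa>A \<kappa>B)
  qed (use A B in auto)
  then obtain k where k: "k \<in> G" "\<forall>x\<in>A \<union> B. k x = \<kappa> x"
    by blast
  \<comment> \<open>The composite changes entries as \<open>s\<close> does up to the constant
    \<open>e\<close>, which \<open>\<rho>\<close> removes.\<close>
  have gk: "M (g (k a)) (g (k b)) = ((M a b \<noteq> w b) \<noteq> e)" if "a \<in> A" "b \<in> B" for a b
    using that k(2) \<kappa>A \<kappa>B g_eq[of "\<alpha> a" "j b"] \<alpha>(2-4) jC by simp
  show "\<exists>g\<in>G. \<forall>a\<in>A. \<forall>b\<in>B. M (g a) (g b) = M (s a) (s b)"
  proof (cases e)
    case True
    have "M (\<rho> (g (k a))) (\<rho> (g (k b))) = M (s a) (s b)" if "a \<in> A" "b \<in> B" for a b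
    proof -
      have "g (k a) \<in> U" "g (k b) \<in> V"
        using that A B side_perm_mem[OF perm[OF g(1)]] side_perm_mem[OF perm[OF k(1)]] by auto
      moreover have "a \<in> U" "b \<in> V" using that A B by auto
      ultimately show ?thesis
        using rho(2) gk[OF that] True s(2) by simp
    qed
    then show ?thesis
      using comp[OF rho(1) comp[OF g(1) k(1)]] by (intro bexI[of _ "\<rho> \<circ> (g \<circ> k)"]) simp_all
  next
    case False
    have "M (g (k a)) (g (k b)) = M (s a) (s b)" if "a \<in> A" "b \<in> B" for a b
    proof -
      have "a \<in> U" "b \<in> V" using that A B by auto
      then show ?thesis using gk[OF that] False s(2) by simp
    qed
    then show ?thesis
      using comp[OF g(1) k(1)] by (intro bexI[of _ "g \<circ> k"]) simp_all
  qed
qed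

text \<open>Every switch at \<open>v\<close> is demanded, to match the generators of
  \<open>switch_group\<close>; any two of them differ by an automorphism.\<close>

definition has_col_switches :: bool where
  "has_col_switches \<longleftrightarrow> (\<forall>v\<in>V. \<forall>s. side_perm U V s \<longrightarrow>
     (\<forall>a\<in>U. \<forall>b\<in>V. M (s a) (s b) = (M a b \<noteq> (b = v))) \<longrightarrow> s \<in> G)"

lemma has_col_switches_if:
  assumes rect_invariant "bip_group.all_exch_card V U G 1"
  shows has_col_switches
  unfolding has_col_switches_def
proof (intro ballI allI impI)
  fix v s assume "side_perm U V s" "\<forall>a\<in>U. \<forall>b\<in>V. M (s a) (s b) = (M a b \<noteq> (b = v))"
  then show "s \<in> G"
    using col_switch_mem[OF assms, of s "\<lambda>b. b = v"] by blast
qed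

lemma ex_col_switches:
  assumes has_col_switches and W: "finite W" "W \<subseteq> V"
  shows "\<exists>h\<in>G. \<forall>a\<in>U. \<forall>b\<in>V. M (h a) (h b) = (M a b \<noteq> (b \<in> W))"
  using W
proof (induction W)
  case empty
  then show ?case using id_mem by (intro bexI[of _ id]) simp_all
next
  case (insert v W)
  then obtain h where h: "h \<in> G" "\<forall>a\<in>U. \<forall>b\<in>V. M (h a) (h b) = (M a b \<noteq> (b \<in> W))"
    by auto
  note mem = side_perm_mem[OF perm[OF h(1)]]
  have inj: "inj h"
    using perm[OF h(1)] by (simp add: side_perm_def bij_is_inj)
  \<comment> \<open>The earlier switches have moved \<open>v\<close>, so the next one is taken at
    \<open>h v\<close>.\<close>
  obtain s where s: "side_perm U V s" "\<forall>a\<in>U. \<forall>b\<in>V. M (s a) (s b) = (M a b \<noteq> (b = h v))"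
    using ex_switch_cols[of "{h v}"] by auto
  have "s \<in> G"
    using assms(1) s insert.prems mem unfolding has_col_switches_def by blast
  moreover have "M (s (h a)) (s (h b)) = (M a b \<noteq> (b \<in> insert v W))" if "a \<in> U" "b \<in> V" for a b
    using that s(2) h(2) mem insert.hyps(2) inj by (auto simp: inj_eq)
  ultimately show ?case
    using comp[OF _ h(1)] by (intro bexI[of _ "s \<circ> h"]) simp_all
qed

end

text \<open>\<open>H\<close> is assumed to have only the switches that exchangeability in
  \<open>G\<close> calls for. On a finite rectangle an element of \<open>G\<close> is imitated by
  row switches, followed by column switches or \<open>\<rho>\<close>.\<close>

lemma bip_group_subset:
  assumes G: "bip_group U V M G \<rho>" and H: "bip_group U V M H \<rho>"
    and rect: "bip_group.rect_invariant U V M G"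
    and rows: "bip_group.all_exch_card U V G 1 \<Longrightarrow> bip_group.has_col_switches V U (\<lambda>b a. M a b) H"
    and cols: "bip_group.all_exch_card V U G 1 \<Longrightarrow> bip_group.has_col_switches U V M H"
  shows "G \<subseteq> H"
proof
  interpret G: bip_group U V M G \<rho> by fact
  interpret G': bip_group V U "\<lambda>b a. M a b" G \<rho> by (rule G.dual_group)
  interpret H: bip_group U V M H \<rho> by fact
  interpret H': bip_group V U "\<lambda>b a. M a b" H \<rho> by (rule H.dual_group)
  fix f assume f: "f \<in> G"
  show "f \<in> H"
  proof (rule H.local_mem[OF G.perm[OF f]])
    fix A B assume A: "finite A" "A \<subseteq> U" and B: "finite B" "B \<subseteq> V"
    obtain a0 where a0: "a0 \<in> U"
      using G.infinite_row infinite_imp_nonempty by blast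
    obtain b0 where b0: "b0 \<in> V"
      using G.infinite_col infinite_imp_nonempty by blast
    define d where "d a b \<longleftrightarrow> M (f a) (f b) \<noteq> M a b" for a b
    \<comment> \<open>The base point \<open>(a0, b0)\<close> splits the changes into a row part,
      which vanishes at \<open>a0\<close>, and the column part \<open>d a0 b\<close>.\<close>
    have d: "d a b = ((d a b0 \<noteq> d a0 b0) \<noteq> d a0 b)" if "a \<in> U" "b \<in> V" for a b
      using G.rect_invariantD[OF rect f that(1) a0 that(2) b0] unfolding d_def by argo
    have "\<exists>h\<in>H. \<forall>a\<in>A. \<forall>b\<in>V. M (h a) (h b) = (M a b \<noteq> (d a b0 \<noteq> d a0 b0))"
    proof (cases "G.all_exch_card 1")
      case True
      define W where "W = {a\<in>A. d a b0 \<noteq> d a0 b0}"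
      have "finite W" "W \<subseteq> U"
        using A by (auto simp: W_def)
      then obtain h where h: "h \<in> H" "\<forall>b\<in>V. \<forall>a\<in>U. M (h a) (h b) = (M a b \<noteq> (a \<in> W))"
        using H'.ex_col_switches[OF rows[OF True]] by blast
      have "M (h a) (h b) = (M a b \<noteq> (d a b0 \<noteq> d a0 b0))" if "a \<in> A" "b \<in> V" for a b
        using h(2) that A(2) by (auto simp: W_def)
      then show ?thesis using h(1) by blast
    next
      case False
      then have "d a b0 = d a0 b0" if "a \<in> A" for a
        using G.flip_row_independent[OF _ f _ a0 b0] that A(2) unfolding d_def by blast
      then show ?thesis
        using H.id_mem by (intro bexI[of _ id]) simp_all
    qed
    then obtain h1 where h1: "h1 \<in> H"
      "\<And>a b. a \<in> A \<Longrightarrow> b \<in> V \<Longrightarrow> M (h1 a) (h1 b) = (M a b \<noteq> (d a b0 \<noteq> d a0 b0))"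
      by blast
    note mem1 = side_perm_mem[OF H.perm[OF h1(1)]]
    \<comment> \<open>The column part is applied after \<open>h1\<close>, so its switches sit at the
      columns \<open>h1 b\<close>. If columns are not all exchangeable over one row, this part is
      constant and \<open>\<rho>\<close> or the identity realises it.\<close>
    have "\<exists>h\<in>H. \<forall>a\<in>U. \<forall>b\<in>B. M (h a) (h (h1 b)) = (M a (h1 b) \<noteq> d a0 b)"
    proof (cases "G'.all_exch_card 1")
      case True
      define W where "W = h1 ` {b\<in>B. d a0 b}"
      have "inj h1"
        using H.perm[OF h1(1)] by (simp add: side_perm_def bij_is_inj)
      then have W: "h1 b \<in> W \<longleftrightarrow> d a0 b" if "b \<in> B" for b
        using that by (auto simp: W_def inj_eq)
      have "finite W" "W \<subseteq> V"
        using B mem1 by (auto simp: W_def)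
      then obtain h where h: "h \<in> H" "\<forall>a\<in>U. \<forall>b\<in>V. M (h a) (h b) = (M a b \<noteq> (b \<in> W))"
        using H.ex_col_switches[OF cols[OF True]] by blast
      have "M (h a) (h (h1 b)) = (M a (h1 b) \<noteq> d a0 b)" if "a \<in> U" "b \<in> B" for a b
        using h(2) that B(2) mem1 W by auto
      then show ?thesis using h(1) by blast
    next
      case False
      then have const: "d a0 b = d a0 b0" if "b \<in> B" for b
        using G'.flip_row_independent[OF _ f _ b0 a0] that B(2) unfolding d_def by blast
      show ?thesis
      proof (cases "d a0 b0")
        case True
        have "M (\<rho> a) (\<rho> (h1 b)) = (M a (h1 b) \<noteq> d a0 b)" if "a \<in> U" "b \<in> B" for a b
          using H.rho(2)[OF that(1), of "h1 b"] that B(2) mem1 const True by auto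
        then show ?thesis using H.rho(1) by blast
      next
        case False
        then show ?thesis
          using const H.id_mem by (intro bexI[of _ id]) simp_all
      qed
    qed
    then obtain h2 where h2: "h2 \<in> H"
      "\<And>a b. a \<in> U \<Longrightarrow> b \<in> B \<Longrightarrow> M (h2 a) (h2 (h1 b)) = (M a (h1 b) \<noteq> d a0 b)"
      by blast
    have "M (h2 (h1 a)) (h2 (h1 b)) = M (f a) (f b)" if "a \<in> A" "b \<in> B" for a b
    proof -
      have ab: "a \<in> U" "b \<in> V" using that A B by auto
      have "M (h2 (h1 a)) (h2 (h1 b)) = ((M a b \<noteq> (d a b0 \<noteq> d a0 b0)) \<noteq> d a0 b)"
        using h2(2)[of "h1 a" b] h1(2)[OF that(1) ab(2)] that(2) ab mem1 by simp
      also have "\<dots> = (M a b \<noteq> d a b)"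
        using d[OF ab] by argo
      finally show ?thesis
        unfolding d_def by argo
    qed
    then show "\<exists>g\<in>H. \<forall>a\<in>A. \<forall>b\<in>B. M (g a) (g b) = M (f a) (f b)"
      using H.comp[OF h2(1) h1(1)] by (intro bexI[of _ "h2 \<circ> h1"]) simp_all
  qed
qed

section \<open>Closed groups of vertex permutations\<close>

lemma Sym_lr_mult: "mult (Sym_lr \<Gamma>) = mult (BijGroup (verts \<Gamma>))"
  and Sym_lr_one: "one (Sym_lr \<Gamma>) = one (BijGroup (verts \<Gamma>))"
  by (simp_all add: Sym_lr_def)

lemma restrict_side_perm_Bij:
  assumes "side_perm (Rl \<Gamma>) (Rr \<Gamma>) p"
  shows "restrict p (verts \<Gamma>) \<in> Bij (verts \<Gamma>)"
  using assms unfolding side_perm_def Bij_def verts_def bij_betw_def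
  by (auto simp: image_Un inj_on_def bij_def)

lemma restrict_side_perm:
  assumes "side_perm (Rl \<Gamma>) (Rr \<Gamma>) p"
  shows "restrict p (verts \<Gamma>) \<in> carrier (Sym_lr \<Gamma>)"
  using assms restrict_side_perm_Bij[OF assms] unfolding side_perm_def Sym_lr_def verts_def by auto

text \<open>Elements of \<^term>\<open>carrier (Sym_lr \<Gamma>)\<close> are undefined off the vertex set; extending them by
  the identity turns composition and inversion into those of total bijections.\<close>

definition total_ext :: "'v bigraph \<Rightarrow> ('v \<Rightarrow> 'v) \<Rightarrow> 'v \<Rightarrow> 'v" where
  "total_ext \<Gamma> f x = (if x \<in> verts \<Gamma> then f x else x)"

lemma total_ext:
  assumes "f \<in> carrier (Sym_lr \<Gamma>)"
  shows "side_perm (Rl \<Gamma>) (Rr \<Gamma>) (total_ext \<Gamma> f)" "restrict (total_ext \<Gamma> f) (verts \<Gamma>) = f"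
proof -
  have f: "f \<in> extensional (verts \<Gamma>)" "bij_betw f (verts \<Gamma>) (verts \<Gamma>)"
    "f ` Rl \<Gamma> = Rl \<Gamma>" "f ` Rr \<Gamma> = Rr \<Gamma>"
    using assms by (auto simp: Sym_lr_def Bij_def)
  have "bij_betw (total_ext \<Gamma> f) (verts \<Gamma> \<union> - verts \<Gamma>) (verts \<Gamma> \<union> - verts \<Gamma>)"
  proof (rule bij_betw_combine)
    show "bij_betw (total_ext \<Gamma> f) (verts \<Gamma>) (verts \<Gamma>)"
      using f(2) by (rule bij_betw_cong[THEN iffD1, rotated]) (simp add: total_ext_def)
    show "bij_betw (total_ext \<Gamma> f) (- verts \<Gamma>) (- verts \<Gamma>)"
      by (rule bij_betw_cong[THEN iffD1, rotated, OF bij_betw_id]) (simp add: total_ext_def)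
  qed simp
  moreover have "total_ext \<Gamma> f ` X = f ` X" if "X \<subseteq> verts \<Gamma>" for X
    using that by (auto simp: total_ext_def image_iff)
  ultimately show "side_perm (Rl \<Gamma>) (Rr \<Gamma>) (total_ext \<Gamma> f)"
    using f(3,4) unfolding side_perm_def Compl_partition by (simp add: verts_def)
  show "restrict (total_ext \<Gamma> f) (verts \<Gamma>) = f"
    using f(1) by (auto simp: total_ext_def fun_eq_iff extensional_def)
qed

lemma restrict_comp:
  assumes "side_perm (Rl \<Gamma>) (Rr \<Gamma>) p" "side_perm (Rl \<Gamma>) (Rr \<Gamma>) q"
  shows "mult (BijGroup (verts \<Gamma>)) (restrict p (verts \<Gamma>)) (restrict q (verts \<Gamma>))
    = restrict (p \<circ> q) (verts \<Gamma>)"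
proof -
  have "q x \<in> verts \<Gamma>" if "x \<in> verts \<Gamma>" for x
    using that side_perm_mem[OF assms(2)] by (auto simp: verts_def)
  then show ?thesis
    using restrict_side_perm_Bij[OF assms(1)] restrict_side_perm_Bij[OF assms(2)]
    by (auto simp: BijGroup_def compose_def fun_eq_iff)
qed

lemma restrict_inv_comp:
  assumes "side_perm (Rl \<Gamma>) (Rr \<Gamma>) p"
  shows "mult (BijGroup (verts \<Gamma>)) (restrict (inv_into UNIV p) (verts \<Gamma>)) (restrict p (verts \<Gamma>))
    = one (BijGroup (verts \<Gamma>))"
  unfolding restrict_comp[OF side_perm_inv[OF assms] assms]
  using side_perm_inv_simps[OF assms] by (auto simp: BijGroup_def fun_eq_iff)

lemma group_Sym_lr: "group (Sym_lr \<Gamma>)"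
proof -
  interpret B: group "BijGroup (verts \<Gamma>)" by (rule group_BijGroup)
  have "subgroup (carrier (Sym_lr \<Gamma>)) (BijGroup (verts \<Gamma>))"
  proof (rule B.subgroupI)
    show "carrier (Sym_lr \<Gamma>) \<subseteq> carrier (BijGroup (verts \<Gamma>))"
      by (auto simp: Sym_lr_def BijGroup_def)
    have "side_perm (Rl \<Gamma>) (Rr \<Gamma>) id"
      by (simp add: side_perm_def)
    then show "carrier (Sym_lr \<Gamma>) \<noteq> {}"
      using restrict_side_perm by blast
  next
    fix f assume f: "f \<in> carrier (Sym_lr \<Gamma>)"
    note p = total_ext[OF f]
    have "inv\<^bsub>BijGroup (verts \<Gamma>)\<^esub> f = restrict (inv_into UNIV (total_ext \<Gamma> f)) (verts \<Gamma>)"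
      using restrict_inv_comp[OF p(1)] restrict_side_perm_Bij[OF p(1)]
        restrict_side_perm_Bij[OF side_perm_inv[OF p(1)]] unfolding p(2)
      by (intro B.inv_equality) (simp_all add: BijGroup_def)
    then show "inv\<^bsub>BijGroup (verts \<Gamma>)\<^esub> f \<in> carrier (Sym_lr \<Gamma>)"
      using restrict_side_perm[OF side_perm_inv[OF p(1)]] by simp
    fix g assume "g \<in> carrier (Sym_lr \<Gamma>)"
    note q = total_ext[OF this]
    show "f \<otimes>\<^bsub>BijGroup (verts \<Gamma>)\<^esub> g \<in> carrier (Sym_lr \<Gamma>)"
      using restrict_comp[OF p(1) q(1)] restrict_side_perm[OF side_perm_comp[OF p(1) q(1)]]
      unfolding p(2) q(2) by simp
  qed
  then have "group (BijGroup (verts \<Gamma>)\<lparr>carrier := carrier (Sym_lr \<Gamma>)\<rparr>)"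
    by (rule B.subgroup_imp_group)
  then show ?thesis
    by (simp add: Sym_lr_def)
qed

text \<open>A basic neighbourhood of \<open>f\<close> constrains only finitely many coordinates. If
  \<open>f\<close> were outside \<open>G\<close>, a neighbourhood missing \<open>G\<close> would
  contain an element of \<open>G\<close> that matches \<open>f\<close> on these coordinates.\<close>

lemma closed_subgroup_approx:
  assumes G: "closed_subgroup \<Gamma> G" and f: "f \<in> carrier (Sym_lr \<Gamma>)"
    and approx: "\<And>F. finite F \<Longrightarrow> F \<subseteq> verts \<Gamma> \<Longrightarrow> \<exists>g\<in>G. \<forall>x\<in>F. g x = f x"
  shows "f \<in> G"
proof (rule ccontr)
  assume fG: "f \<notin> G"
  let ?P = "product_topology (\<lambda>_. discrete_topology (verts \<Gamma>)) (verts \<Gamma>)"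
  have car: "h \<in> topspace ?P" if "h \<in> carrier (Sym_lr \<Gamma>)" for h
    using that by (auto simp: Sym_lr_def Bij_def bij_betw_def PiE_def)
  have top: "topspace (Sym_lr_top \<Gamma>) = carrier (Sym_lr \<Gamma>)"
    unfolding Sym_lr_top_def using car by (auto simp: topspace_subtopology)
  have "openin (Sym_lr_top \<Gamma>) (carrier (Sym_lr \<Gamma>) - G)"
    using G unfolding closed_subgroup_def closedin_def top by blast
  then obtain T where T: "openin ?P T" "carrier (Sym_lr \<Gamma>) - G = T \<inter> carrier (Sym_lr \<Gamma>)"
    unfolding Sym_lr_top_def openin_subtopology by blast
  have "f \<in> T" using T(2) f fG by blast
  then obtain W where W: "finite {i \<in> verts \<Gamma>. W i \<noteq> topspace (discrete_topology (verts \<Gamma>))}"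
    "f \<in> Pi\<^sub>E (verts \<Gamma>) W" "Pi\<^sub>E (verts \<Gamma>) W \<subseteq> T"
    using T(1) unfolding openin_product_topology_alt by blast
  obtain g where g: "g \<in> G" "\<forall>x\<in>{i \<in> verts \<Gamma>. W i \<noteq> verts \<Gamma>}. g x = f x"
    using approx[OF W(1)] by auto
  have gc: "g \<in> carrier (Sym_lr \<Gamma>)"
    using G g(1) unfolding closed_subgroup_def using subgroup.subset by blast
  have "g \<in> Pi\<^sub>E (verts \<Gamma>) W"
  proof (rule PiE_I)
    fix x assume x: "x \<in> verts \<Gamma>"
    show "g x \<in> W x"
    proof (cases "W x = verts \<Gamma>")
      case True
      then show ?thesis using car[OF gc] x by (auto simp: PiE_iff)
    next
      case False
      then show ?thesis using g(2) W(2) x by (auto simp: PiE_iff)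
    qed
  qed (use car[OF gc] in \<open>auto simp: PiE_iff extensional_def\<close>)
  then show False
    using W(3) T(2) gc g(1) by blast
qed

definition total_exts :: "'v bigraph \<Rightarrow> ('v \<Rightarrow> 'v) set \<Rightarrow> ('v \<Rightarrow> 'v) set" where
  "total_exts \<Gamma> G = {p. side_perm (Rl \<Gamma>) (Rr \<Gamma>) p \<and> restrict p (verts \<Gamma>) \<in> G}"

lemma mem_total_exts_iff:
  assumes "f \<in> carrier (Sym_lr \<Gamma>)"
  shows "total_ext \<Gamma> f \<in> total_exts \<Gamma> G \<longleftrightarrow> f \<in> G"
  using total_ext[OF assms] by (simp add: total_exts_def)

section \<open>Translation of graphs, switches and closed subgroups into the matrix setting\<close>

lemma random_bip_of_graph:
  assumes "random_bipartite_graph \<Gamma>"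
  shows "random_bip (Rl \<Gamma>) (Rr \<Gamma>) (\<lambda>a b. (a, b) \<in> P1 \<Gamma>)"
proof
  have bg: "Rl \<Gamma> \<inter> Rr \<Gamma> = {}" "P1 \<Gamma> \<inter> P2 \<Gamma> = {}"
    and ext: "\<And>n. extension_property \<Gamma> n" and cnt: "countable (verts \<Gamma>)"
    using assms by (auto simp: random_bipartite_graph_def bipartite_graph_def)
  show "Rl \<Gamma> \<inter> Rr \<Gamma> = {}" by fact
  show "countable (Rl \<Gamma>)" "countable (Rr \<Gamma>)"
    using cnt by (auto simp: verts_def)
  show "\<exists>v\<in>Rr \<Gamma>. \<forall>x\<in>X. ((x, v) \<in> P1 \<Gamma>) = t x" if X: "finite X" "X \<subseteq> Rl \<Gamma>" for X t
  proof -
    let ?A = "{x\<in>X. t x}" and ?B = "{x\<in>X. \<not> t x}"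
    have "size_at_most (card X) ?A" "size_at_most (card X) ?B" "size_at_most (card X) {}"
      using X by (auto simp: size_at_most_def intro: card_mono)
    then obtain v where v: "v \<in> Rr \<Gamma>" "\<forall>x\<in>?A. (x, v) \<in> P1 \<Gamma>" "\<forall>x\<in>?B. (x, v) \<in> P2 \<Gamma>"
      using ext[of "card X", unfolded extension_property_def, rule_format, of ?A ?B "{}" "{}"] X(2)
      by blast
    then show ?thesis
      using bg(2) by (intro bexI[of _ v]) blast+
  qed
  show "\<exists>u\<in>Rl \<Gamma>. \<forall>y\<in>Y. ((u, y) \<in> P1 \<Gamma>) = t y" if Y: "finite Y" "Y \<subseteq> Rr \<Gamma>" for Y t
  proof -
    let ?A = "{y\<in>Y. t y}" and ?B = "{y\<in>Y. \<not> t y}"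
    have "size_at_most (card Y) ?A" "size_at_most (card Y) ?B" "size_at_most (card Y) {}"
      using Y by (auto simp: size_at_most_def intro: card_mono)
    then obtain u where u: "u \<in> Rl \<Gamma>" "\<forall>y\<in>?A. (u, y) \<in> P1 \<Gamma>" "\<forall>y\<in>?B. (u, y) \<in> P2 \<Gamma>"
      using ext[of "card Y", unfolded extension_property_def, rule_format, of "{}" "{}" ?A ?B] Y(2)
      by blast
    then show ?thesis
      using bg(2) by (intro bexI[of _ u]) blast+
  qed
qed

lemma restrict_Aut:
  assumes bg: "bipartite_graph \<Gamma>" and f: "side_perm (Rl \<Gamma>) (Rr \<Gamma>) f"
    and pres: "\<And>a b. a \<in> Rl \<Gamma> \<Longrightarrow> b \<in> Rr \<Gamma> \<Longrightarrow> (f a, f b) \<in> P1 \<Gamma> \<longleftrightarrow> (a, b) \<in> P1 \<Gamma>"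
  shows "restrict f (verts \<Gamma>) \<in> Aut \<Gamma>"
proof -
  have P: "P1 \<Gamma> \<subseteq> Rl \<Gamma> \<times> Rr \<Gamma>" "P2 \<Gamma> = Rl \<Gamma> \<times> Rr \<Gamma> - P1 \<Gamma>"
    using bg by (auto simp: bipartite_graph_def)
  note mem = side_perm_mem[OF f]
  have 1: "(x, y) \<in> P1 \<Gamma> \<longleftrightarrow> (f x, f y) \<in> P1 \<Gamma>" for x y
  proof (cases "x \<in> Rl \<Gamma> \<and> y \<in> Rr \<Gamma>")
    case True
    then show ?thesis using pres by simp
  next
    case False
    then have "(x, y) \<notin> P1 \<Gamma>" "(f x, f y) \<notin> P1 \<Gamma>"
      using P(1) mem by auto
    then show ?thesis by simp
  qed
  have 2: "(x, y) \<in> P2 \<Gamma> \<longleftrightarrow> (f x, f y) \<in> P2 \<Gamma>" for x y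
    unfolding P(2) using 1[of x y] mem by simp
  show ?thesis
    unfolding Aut_def using restrict_side_perm_Bij[OF f] 1 2 mem by simp
qed

text \<open>The sides are disjoint, so \<open>a\<close> and \<open>b\<close> are distinct and the
  cardinality test says that exactly one of them lies in \<open>A\<close>. On cross-edges
  \<open>P2\<close> is the complement of \<open>P1\<close>, so both relations give the same
  condition.\<close>

lemma is_switch_iff:
  assumes bg: "bipartite_graph \<Gamma>" and f: "side_perm (Rl \<Gamma>) (Rr \<Gamma>) f"
  shows "is_switch \<Gamma> A (restrict f (verts \<Gamma>)) \<longleftrightarrow>
    (\<forall>a\<in>Rl \<Gamma>. \<forall>b\<in>Rr \<Gamma>. (f a, f b) \<in> P1 \<Gamma> \<longleftrightarrow> (((a, b) \<in> P1 \<Gamma>) \<noteq> ((a \<in> A) \<noteq> (b \<in> A))))"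
proof -
  have disj: "Rl \<Gamma> \<inter> Rr \<Gamma> = {}" and P2: "P2 \<Gamma> = Rl \<Gamma> \<times> Rr \<Gamma> - P1 \<Gamma>"
    using bg by (auto simp: bipartite_graph_def)
  note mem = side_perm_mem[OF f]
  have "(\<forall>P\<in>{P1 \<Gamma>, P2 \<Gamma>}. ((a, b) \<in> P \<longleftrightarrow> (restrict f (verts \<Gamma>) a, restrict f (verts \<Gamma>) b) \<in> P)
        \<longleftrightarrow> card ({a, b} \<inter> A) \<noteq> 1)
     \<longleftrightarrow> ((f a, f b) \<in> P1 \<Gamma> \<longleftrightarrow> (((a, b) \<in> P1 \<Gamma>) \<noteq> ((a \<in> A) \<noteq> (b \<in> A))))"
    if "a \<in> Rl \<Gamma>" "b \<in> Rr \<Gamma>" for a b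
  proof -
    have "a \<noteq> b" using that disj by auto
    then have "card ({a, b} \<inter> A) \<noteq> 1 \<longleftrightarrow> \<not> ((a \<in> A) \<noteq> (b \<in> A))"
      by (cases "a \<in> A"; cases "b \<in> A") (simp_all add: Int_insert_left)
    moreover have "a \<in> verts \<Gamma>" "b \<in> verts \<Gamma>"
      using that by (auto simp: verts_def)
    ultimately show ?thesis
      unfolding P2 using that mem by auto
  qed
  then show ?thesis
    unfolding is_switch_def using restrict_side_perm_Bij[OF f] by simp
qed

lemma bip_group_of_closed_subgroup:
  assumes \<Gamma>: "random_bipartite_graph \<Gamma>" and \<rho>: "\<rho> \<in> carrier (Sym_lr \<Gamma>)" "is_switch \<Gamma> (Rl \<Gamma>) \<rho>"
    and G: "closed_subgroup \<Gamma> G" "Aut \<Gamma> \<subseteq> G" "\<rho> \<in> G"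
  shows "bip_group (Rl \<Gamma>) (Rr \<Gamma>) (\<lambda>a b. (a, b) \<in> P1 \<Gamma>) (total_exts \<Gamma> G) (total_ext \<Gamma> \<rho>)"
proof (intro bip_group.intro random_bip_of_graph[OF \<Gamma>] bip_group_axioms.intro)
  have bg: "bipartite_graph \<Gamma>"
    using \<Gamma> by (simp add: random_bipartite_graph_def)
  have sub: "subgroup G (Sym_lr \<Gamma>)"
    using G(1) by (simp add: closed_subgroup_def)
  show "side_perm (Rl \<Gamma>) (Rr \<Gamma>) g" if "g \<in> total_exts \<Gamma> G" for g
    using that by (simp add: total_exts_def)
  show "g \<circ> h \<in> total_exts \<Gamma> G" if "g \<in> total_exts \<Gamma> G" "h \<in> total_exts \<Gamma> G" for g h
  proof -
    have "restrict (g \<circ> h) (verts \<Gamma>) \<in> G"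
      using that restrict_comp[of \<Gamma> g h] subgroup.m_closed[OF sub]
      by (metis (no_types, lifting) Sym_lr_mult mem_Collect_eq total_exts_def)
    then show ?thesis
      using that side_perm_comp by (auto simp: total_exts_def)
  qed
  show "inv_into UNIV g \<in> total_exts \<Gamma> G" if g: "g \<in> total_exts \<Gamma> G" for g
  proof -
    have p: "side_perm (Rl \<Gamma>) (Rr \<Gamma>) g" "restrict g (verts \<Gamma>) \<in> G"
      using g by (auto simp: total_exts_def)
    have "inv\<^bsub>Sym_lr \<Gamma>\<^esub> (restrict g (verts \<Gamma>)) = restrict (inv_into UNIV g) (verts \<Gamma>)"
      using restrict_inv_comp[OF p(1)] restrict_side_perm[OF p(1)]
        restrict_side_perm[OF side_perm_inv[OF p(1)]]
      by (intro group.inv_equality[OF group_Sym_lr]) (simp_all add: Sym_lr_mult Sym_lr_one)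
    then show ?thesis
      using subgroup.m_inv_closed[OF sub p(2)] side_perm_inv[OF p(1)] by (simp add: total_exts_def)
  qed
  show "f \<in> total_exts \<Gamma> G" if f: "side_perm (Rl \<Gamma>) (Rr \<Gamma>) f"
    "\<And>F. finite F \<Longrightarrow> F \<subseteq> Rl \<Gamma> \<union> Rr \<Gamma> \<Longrightarrow> \<exists>g\<in>total_exts \<Gamma> G. \<forall>x\<in>F. g x = f x" for f
  proof -
    have "restrict f (verts \<Gamma>) \<in> G"
    proof (rule closed_subgroup_approx[OF G(1) restrict_side_perm[OF f(1)]])
      fix F assume F: "finite F" "F \<subseteq> verts \<Gamma>"
      then obtain g where g: "g \<in> total_exts \<Gamma> G" "\<forall>x\<in>F. g x = f x"
        using f(2)[of F] unfolding verts_def by blast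
      then have "\<forall>x\<in>F. restrict g (verts \<Gamma>) x = restrict f (verts \<Gamma>) x"
        using F(2) by (auto simp: restrict_def)
      moreover have "restrict g (verts \<Gamma>) \<in> G"
        using g(1) by (simp add: total_exts_def)
      ultimately show "\<exists>g\<in>G. \<forall>x\<in>F. g x = restrict f (verts \<Gamma>) x" by blast
    qed
    then show ?thesis using f(1) by (simp add: total_exts_def)
  qed
  show "f \<in> total_exts \<Gamma> G" if "side_perm (Rl \<Gamma>) (Rr \<Gamma>) f"
    "\<And>a b. a \<in> Rl \<Gamma> \<Longrightarrow> b \<in> Rr \<Gamma> \<Longrightarrow> ((f a, f b) \<in> P1 \<Gamma>) = ((a, b) \<in> P1 \<Gamma>)" for f
    using restrict_Aut[OF bg that] that(1) G(2) by (auto simp: total_exts_def)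
  show "total_ext \<Gamma> \<rho> \<in> total_exts \<Gamma> G"
    using mem_total_exts_iff[OF \<rho>(1)] G(3) by blast
  show "((total_ext \<Gamma> \<rho> a, total_ext \<Gamma> \<rho> b) \<in> P1 \<Gamma>) = ((a, b) \<notin> P1 \<Gamma>)"
    if "a \<in> Rl \<Gamma>" "b \<in> Rr \<Gamma>" for a b
  proof -
    have "b \<notin> Rl \<Gamma>"
      using bg that by (auto simp: bipartite_graph_def)
    then show ?thesis
      using is_switch_iff[OF bg total_ext(1)[OF \<rho>(1)], of "Rl \<Gamma>"] \<rho>(2) that
      unfolding total_ext(2)[OF \<rho>(1)] by simp
  qed
qed

lemma has_col_switches_iff:
  assumes \<Gamma>: "random_bipartite_graph \<Gamma>" and \<rho>: "\<rho> \<in> carrier (Sym_lr \<Gamma>)" "is_switch \<Gamma> (Rl \<Gamma>) \<rho>"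
    and G: "closed_subgroup \<Gamma> G" "Aut \<Gamma> \<subseteq> G" "\<rho> \<in> G"
  shows "bip_group.has_col_switches (Rl \<Gamma>) (Rr \<Gamma>) (\<lambda>a b. (a, b) \<in> P1 \<Gamma>) (total_exts \<Gamma> G)
      \<longleftrightarrow> {\<sigma> \<in> carrier (Sym_lr \<Gamma>). \<exists>v\<in>Rr \<Gamma>. is_switch \<Gamma> {v} \<sigma>} \<subseteq> G" (is ?cols)
    and "bip_group.has_col_switches (Rr \<Gamma>) (Rl \<Gamma>) (\<lambda>b a. (a, b) \<in> P1 \<Gamma>) (total_exts \<Gamma> G)
      \<longleftrightarrow> {\<sigma> \<in> carrier (Sym_lr \<Gamma>). \<exists>v\<in>Rl \<Gamma>. is_switch \<Gamma> {v} \<sigma>} \<subseteq> G" (is ?rows)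
proof -
  have bg: "bipartite_graph \<Gamma>"
    using \<Gamma> by (simp add: random_bipartite_graph_def)
  have disj: "Rl \<Gamma> \<inter> Rr \<Gamma> = {}"
    using bg by (simp add: bipartite_graph_def)
  note B = bip_group_of_closed_subgroup[OF assms]
  have col: "is_switch \<Gamma> {v} (restrict s (verts \<Gamma>)) \<longleftrightarrow>
      (\<forall>a\<in>Rl \<Gamma>. \<forall>b\<in>Rr \<Gamma>. ((s a, s b) \<in> P1 \<Gamma>) = (((a, b) \<in> P1 \<Gamma>) \<noteq> (b = v)))"
    if "v \<in> Rr \<Gamma>" "side_perm (Rl \<Gamma>) (Rr \<Gamma>) s" for v s
  proof -
    have "a \<noteq> v" if "a \<in> Rl \<Gamma>" for a
      using \<open>v \<in> Rr \<Gamma>\<close> that disj by auto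
    then show ?thesis
      unfolding is_switch_iff[OF bg that(2)] by simp
  qed
  have row: "is_switch \<Gamma> {v} (restrict s (verts \<Gamma>)) \<longleftrightarrow>
      (\<forall>b\<in>Rr \<Gamma>. \<forall>a\<in>Rl \<Gamma>. ((s a, s b) \<in> P1 \<Gamma>) = (((a, b) \<in> P1 \<Gamma>) \<noteq> (a = v)))"
    if "v \<in> Rl \<Gamma>" "side_perm (Rl \<Gamma>) (Rr \<Gamma>) s" for v s
  proof -
    have "b \<noteq> v" if "b \<in> Rr \<Gamma>" for b
      using \<open>v \<in> Rl \<Gamma>\<close> that disj by auto
    then show ?thesis
      unfolding is_switch_iff[OF bg that(2)] by auto
  qed
  have all: "(\<forall>v\<in>Z. \<forall>s. side_perm (Rl \<Gamma>) (Rr \<Gamma>) s \<longrightarrow> is_switch \<Gamma> {v} (restrict s (verts \<Gamma>)) \<longrightarrow>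
      s \<in> total_exts \<Gamma> G) \<longleftrightarrow> {\<sigma> \<in> carrier (Sym_lr \<Gamma>). \<exists>v\<in>Z. is_switch \<Gamma> {v} \<sigma>} \<subseteq> G"
    (is "?A \<longleftrightarrow> ?B") for Z
  proof
    assume ?A
    show ?B
    proof clarify
      fix \<sigma> v assume \<sigma>: "\<sigma> \<in> carrier (Sym_lr \<Gamma>)" "v \<in> Z" "is_switch \<Gamma> {v} \<sigma>"
      then have "total_ext \<Gamma> \<sigma> \<in> total_exts \<Gamma> G"
        using \<open>?A\<close> total_ext[OF \<sigma>(1)] by metis
      then show "\<sigma> \<in> G"
        using mem_total_exts_iff[OF \<sigma>(1)] by blast
    qed
  next
    assume ?B
    then show ?A
      using restrict_side_perm by (auto simp: total_exts_def)
  qed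
  show ?cols
    unfolding bip_group.has_col_switches_def[OF B] all[symmetric]
    by (intro ball_cong all_cong1 imp_cong refl) (simp add: col)
  show ?rows
    unfolding bip_group.has_col_switches_def[OF bip_group.dual_group[OF B]] all[symmetric]
      side_perm_commute[of "Rr \<Gamma>"] by (intro ball_cong all_cong1 imp_cong refl) (simp add: row)
qed

section \<open>Generated closed groups and the two inclusions\<close>

lemma closed_generate_superset: "S \<subseteq> closed_generate \<Gamma> S"
  unfolding closed_generate_def by blast

lemma closed_generate_least: "closed_subgroup \<Gamma> H \<Longrightarrow> S \<subseteq> H \<Longrightarrow> closed_generate \<Gamma> S \<subseteq> H"
  unfolding closed_generate_def by blast

theorem theorem1p6:
  fixes \<Gamma> :: "'v bigraph" and \<rho> :: "'v \<Rightarrow> 'v" and G :: "('v \<Rightarrow> 'v) set"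
  assumes "random_bipartite_graph \<Gamma>"
    and "\<rho> \<in> carrier (Sym_lr \<Gamma>)"
    and "is_switch \<Gamma> (Rl \<Gamma>) \<rho>"
    and "closed_subgroup \<Gamma> G"
    and "star_group \<Gamma> \<rho> (Aut \<Gamma>) \<subseteq> G"
    and "G \<subset> carrier (Sym_lr \<Gamma>)"
  shows "\<exists>X \<subseteq> {L, R}. G = star_group \<Gamma> \<rho> (switch_group \<Gamma> X)"
proof -
  let ?U = "Rl \<Gamma>" and ?V = "Rr \<Gamma>" and ?M = "\<lambda>a b. (a, b) \<in> P1 \<Gamma>" and ?G = "total_exts \<Gamma> G"
  have G: "Aut \<Gamma> \<subseteq> G" "\<rho> \<in> G"
    using assms(5) closed_generate_superset unfolding star_group_def by blast+
  interpret G: bip_group ?U ?V ?M ?G "total_ext \<Gamma> \<rho>"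
    by (rule bip_group_of_closed_subgroup[OF assms(1-4) G])
  interpret G': bip_group ?V ?U "\<lambda>b a. ?M a b" ?G "total_ext \<Gamma> \<rho>"
    by (rule G.dual_group)
  obtain f where "f \<in> carrier (Sym_lr \<Gamma>)" "f \<notin> G"
    using assms(6) by blast
  then have rect: G.rect_invariant
    using G.rect_invariant_if_proper total_ext(1) mem_total_exts_iff by blast
  \<comment> \<open>Exchangeability of rows over one column yields switches at rows, which are the
    column switches of the transposed group; hence the passage between \<open>G\<close> and
    \<open>G'\<close> in the two cases below.\<close>
  define X where "X = {i. case i of L \<Rightarrow> G.all_exch_card 1 | R \<Rightarrow> G'.all_exch_card 1}"
  define Sw where "Sw i = {\<sigma> \<in> carrier (Sym_lr \<Gamma>). \<exists>v\<in>side_set \<Gamma> i. is_switch \<Gamma> {v} \<sigma>}" for i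
  have sw: "switch_group \<Gamma> X = closed_generate \<Gamma> (Aut \<Gamma> \<union> (\<Union>i\<in>X. Sw i))"
    unfolding switch_group_def Sw_def by (rule arg_cong[where f = "closed_generate \<Gamma>"]) auto
  have "Sw i \<subseteq> G" if "i \<in> X" for i
  proof (cases i)
    case L
    then have G'.has_col_switches
      using that G'.has_col_switches_if[OF G.rect_invariant_dual[OF rect]] by (simp add: X_def)
    then show ?thesis
      using has_col_switches_iff(2)[OF assms(1-4) G] by (simp add: Sw_def L)
  next
    case R
    then have G.has_col_switches
      using that G.has_col_switches_if[OF rect] by (simp add: X_def)
    then show ?thesis
      using has_col_switches_iff(1)[OF assms(1-4) G] by (simp add: Sw_def R)
  qed
  then have "switch_group \<Gamma> X \<subseteq> G"
    unfolding sw using G(1) by (intro closed_generate_least assms(4)) blast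
  then have "star_group \<Gamma> \<rho> (switch_group \<Gamma> X) \<subseteq> G"
    unfolding star_group_def using G(2) by (intro closed_generate_least assms(4)) blast
  \<comment> \<open>The intersection defining \<open>star_group\<close> is bounded below by treating
    each \<open>H\<close> in it separately; each is a closed group to which
    \<open>bip_group_subset\<close> applies.\<close>
  moreover have "G \<subseteq> H" if H: "closed_subgroup \<Gamma> H" "switch_group \<Gamma> X \<union> {\<rho>} \<subseteq> H" for H
  proof -
    have "Aut \<Gamma> \<union> (\<Union>i\<in>X. Sw i) \<subseteq> H"
      using closed_generate_superset[of "Aut \<Gamma> \<union> (\<Union>i\<in>X. Sw i)" \<Gamma>] H(2) unfolding sw
      by (meson Un_subset_iff order_trans)
    then have H': "Aut \<Gamma> \<subseteq> H" "\<rho> \<in> H" "\<And>i. i \<in> X \<Longrightarrow> Sw i \<subseteq> H"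
      using H(2) by (simp_all add: UN_subset_iff)
    have "?G \<subseteq> total_exts \<Gamma> H"
    proof (rule bip_group_subset[OF G.bip_group_axioms _ rect])
      show "bip_group ?U ?V ?M (total_exts \<Gamma> H) (total_ext \<Gamma> \<rho>)"
        by (rule bip_group_of_closed_subgroup[OF assms(1-3) H(1) H'(1,2)])
      show "bip_group.has_col_switches ?V ?U (\<lambda>b a. ?M a b) (total_exts \<Gamma> H)"
        if "G.all_exch_card 1"
        using H'(3)[of L] that has_col_switches_iff(2)[OF assms(1-3) H(1) H'(1,2)]
        by (simp add: X_def Sw_def)
      show "bip_group.has_col_switches ?U ?V ?M (total_exts \<Gamma> H)"
        if "G'.all_exch_card 1"
        using H'(3)[of R] that has_col_switches_iff(1)[OF assms(1-3) H(1) H'(1,2)]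
        by (simp add: X_def Sw_def)
    qed
    then show ?thesis
      using mem_total_exts_iff assms(6) by blast
  qed
  then have "G \<subseteq> star_group \<Gamma> \<rho> (switch_group \<Gamma> X)"
    unfolding star_group_def closed_generate_def[of _ "switch_group \<Gamma> X \<union> {\<rho>}"] by blast
  moreover have "X \<subseteq> {L, R}"
    using side.exhaust by auto
  ultimately show ?thesis by blast
qed

end
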